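(* Let $R$ be a UFD of characteristic $p>0$, $R[x,y]$ the polynomial ring, $0\ne a\in R$, $0\ne\theta(y)\in yR[y]$, $f:=ax+\theta(y)$, $0\ne F\in R[f]$, and let $\phi\in\operatorname{Aut}_RR[x,y]$ be given by $\phi(y)=y+aF$, $\phi(x)=x+a^{-1}(\theta(y)-\theta(y+aF))$. Assume the ideal $I:=aR[x,y]+\theta'(y)R[x,y]$ is not principal. Then: (i) $R[x,y]^{\phi}$ is not isomorphic to $R[x,y]$ as an $R$-algebra; (ii) if $R=k[z_1,\ldots,z_n]$ is a polynomial ring in $n\ge1$ variables over a field $k$ with $\operatorname{char}k>0$, then $R[x,y]^{\phi}$ is not isomorphic to $R[x,y]$ as a $k$-algebra.
   Context: $\theta'(y)$ denotes the formal derivative; $R[x,y]^{\phi}:=\{u\in R[x,y]\mid\phi(u)=u\}$. *)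

theory Defs
  imports "HOL-Computational_Algebra.Polynomial" "HOL-Computational_Algebra.Factorial_Ring"
          "HOL-Library.Poly_Mapping"
begin

text \<open>R[x,y] is rendered as the type 'a poly poly: the outer polynomial variable is x,
  the inner one (the coefficients, elements of R[y]) is y.\<close>

text \<open>Irreducible and prime elements, written out as in Factorial_Ring (whose versions
  require an algebraic_semidom instance, which the polynomial ring of part (ii) lacks).\<close>
definition irred :: "'a::idom \<Rightarrow> bool" where
  "irred p \<longleftrightarrow> p \<noteq> 0 \<and> \<not> p dvd 1 \<and> (\<forall>a b. p = a * b \<longrightarrow> a dvd 1 \<or> b dvd 1)"

definition prim :: "'a::idom \<Rightarrow> bool" where
  "prim p \<longleftrightarrow> p \<noteq> 0 \<and> \<not> p dvd 1 \<and> (\<forall>a b. p dvd a * b \<longrightarrow> p dvd a \<or> p dvd b)"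

definition ufd :: "'a::idom itself \<Rightarrow> bool" where
  "ufd _ \<longleftrightarrow>
     (\<forall>r::'a. r \<noteq> 0 \<and> \<not> r dvd 1 \<longrightarrow>
        (\<exists>ps. ps \<noteq> [] \<and> (\<forall>p\<in>set ps. irred p) \<and> r = prod_list ps)) \<and>
     (\<forall>p::'a. irred p \<longrightarrow> prim p)"

definition cR :: "'a::comm_ring_1 \<Rightarrow> 'a poly poly" where
  "cR r = [:[:r:]:]"

definition Xv :: "'a::comm_ring_1 poly poly" where
  "Xv = [:0, 1:]"

definition Yv :: "'a::comm_ring_1 poly poly" where
  "Yv = [:[:0, 1:]:]"

definition eval2 :: "'a::comm_ring_1 poly poly \<Rightarrow> 'a poly poly \<Rightarrow> 'a poly poly \<Rightarrow> 'a poly poly" where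
  "eval2 u P Q = poly (map_poly (\<lambda>c. poly (map_poly cR c) Q) u) P"

definition evalY :: "'a::comm_ring_1 poly \<Rightarrow> 'a poly poly \<Rightarrow> 'a poly poly" where
  "evalY th t = poly (map_poly cR th) t"

definition phi_xpart :: "'a::idom \<Rightarrow> 'a poly \<Rightarrow> 'a poly poly \<Rightarrow> 'a poly poly" where
  "phi_xpart a th F = (THE q. cR a * q = evalY th Yv - evalY th (Yv + cR a * F))"

definition phi :: "'a::idom \<Rightarrow> 'a poly \<Rightarrow> 'a poly poly \<Rightarrow> 'a poly poly \<Rightarrow> 'a poly poly" where
  "phi a th F u = eval2 u (Xv + phi_xpart a th F) (Yv + cR a * F)"

definition invariants :: "'a::idom \<Rightarrow> 'a poly \<Rightarrow> 'a poly poly \<Rightarrow> 'a poly poly set" where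
  "invariants a th F = {u. phi a th F u = u}"

definition in_Rf :: "'a::comm_ring_1 poly poly \<Rightarrow> 'a poly poly \<Rightarrow> bool" where
  "in_Rf F f \<longleftrightarrow> (\<exists>g. F = evalY g f)"

definition hyps :: "'a::idom \<Rightarrow> 'a poly \<Rightarrow> 'a poly poly \<Rightarrow> bool" where
  "hyps a th F \<longleftrightarrow>
     a \<noteq> 0 \<and> th \<noteq> 0 \<and> poly th 0 = 0 \<and>
     F \<noteq> 0 \<and> in_Rf F (cR a * Xv + evalY th Yv) \<and>
     \<not> (\<exists>g. {cR a * u + [:pderiv th:] * v | u v. True} = {g * w | w. True})"

definition alg_iso_to_full ::
  "('s \<Rightarrow> 'a::comm_ring_1 poly poly) \<Rightarrow> 'a poly poly set \<Rightarrow> bool" where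
  "alg_iso_to_full emb S \<longleftrightarrow>
     (\<exists>h. bij_betw h S (UNIV :: 'a poly poly set) \<and>
          (\<forall>u\<in>S. \<forall>v\<in>S. h (u + v) = h u + h v \<and> h (u * v) = h u * h v) \<and>
          h 1 = 1 \<and>
          (\<forall>c. \<forall>u\<in>S. h (emb c * u) = emb c * h u))"

end

theory Submission
  imports Defs "HOL-Analysis.Determinants" "HOL-Number_Theory.Cong"
begin

text \<open>
  Write \<open>B = R[x, y]\<close> and \<open>A\<close> for the ring of invariants. Dividing out common factors,
  \<open>a = d r\<close> and \<open>\<theta> = \<theta>\<^sub>1(y ^ p) + d \<theta>\<^sub>2(y)\<close> where no prime divides both \<open>r\<close> and
  \<open>t = \<theta>\<^sub>2'\<close>; so \<open>I = d (r, t)\<close>, and \<open>I\<close> is principal as soon as \<open>(r, t)\<close> is the unit ideal. Put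
  \<open>s = d F\<close>, so that \<open>\<phi>(y) = y + r s\<close>.

  The first ingredient bounds gradients. The orbit of \<open>(x, y)\<close> under \<open>\<phi>\<close> is parametrized by
  polynomials in \<open>s i\<close>, \<open>i \<in> F\<^sub>p\<close>. Taylor expansion of an invariant \<open>u\<close> along it, reduced
  modulo \<open>T ^ p - T\<close>, gives \<open>\<eta> u\<^sub>x + r u\<^sub>y \<in> s ^ (p - 1) (r, t)\<^sup>2\<close> with some \<open>\<eta>\<close>
  congruent to \<open>- t\<close> modulo \<open>r\<close>.

  The second ingredient is a triple of explicit invariants \<open>f'\<close>, \<open>q\<close>, \<open>g\<close> with Jacobians
  \<open>J(f', q) = - r ^ p s ^ (p - 1)\<close> and \<open>J(f', g) = s ^ (p - 1) w\<close>, where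
  \<open>w\<close> is congruent to \<open>t ^ p\<close> modulo \<open>r\<close>.

  If \<open>A\<close> were a polynomial ring with generators \<open>P\<^sub>i\<close> (over \<open>R\<close>, or over \<open>k\<close> with the
  variables of \<open>R\<close> included), the determinant \<open>J\<close> of the Jacobian matrix of the \<open>P\<^sub>i\<close> would, by the
  chain rule, divide both Jacobians, hence \<open>s ^ (p - 1)\<close> because \<open>r\<close> and \<open>w\<close> have no common
  factor. By Cramer's rule the gradient bound for the \<open>P\<^sub>i\<close> yields \<open>J (\<eta>, r) \<subseteq> s ^ (p - 1) (r, t)\<^sup>2\<close>,
  hence \<open>(r, t) = (r, t)\<^sup>2\<close>, and \<open>(r, t)\<close> is the unit ideal by Nakayama's lemma.
\<close>

section \<open>Ring morphisms and derivations\<close>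

locale morphism =
  fixes f :: "'a::idom \<Rightarrow> 'b::idom"
  assumes add: "f (u + v) = f u + f v"
    and mult: "f (u * v) = f u * f v"
    and one: "f 1 = 1"
begin

lemma zero: "f 0 = 0"
  using add[of 0 0] by (metis add_0_left add_right_cancel)

lemma minus: "f (- u) = - f u"
  using add[of u "- u"] zero by (simp add: eq_neg_iff_add_eq_0 add.commute)

lemma diff: "f (u - v) = f u - f v"
  using add[of u "- v"] minus by simp

lemma power: "f (u ^ n) = f u ^ n"
  by (induction n) (simp_all add: one mult)

lemma of_nat: "f (of_nat n) = of_nat n"
  by (induction n) (simp_all add: zero one add)

lemma sum: "f (sum g A) = (\<Sum>i\<in>A. f (g i))"
  by (induction A rule: infinite_finite_induct) (simp_all add: zero add)

lemma poly: "f (poly t x) = poly (map_poly f t) (f x)"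
  by (induction t) (simp_all add: zero map_poly_pCons add mult)

lemma map_poly_morphism: "morphism (map_poly f)"
proof
  show "map_poly f (u + v) = map_poly f u + map_poly f v" for u v
    by (intro poly_eqI) (simp add: coeff_map_poly zero add)
  show "map_poly f (u * v) = map_poly f u * map_poly f v" for u v
    by (intro poly_eqI) (simp add: coeff_map_poly zero coeff_mult sum mult)
  show "map_poly f 1 = 1"
    by (simp add: one)
qed

lemma pderiv: "pderiv (map_poly f t) = map_poly f (pderiv t)"
  by (intro poly_eqI) (simp add: coeff_pderiv coeff_map_poly zero mult of_nat flip: of_nat_Suc)

end

lemma morphism_comp: "morphism f \<Longrightarrow> morphism g \<Longrightarrow> morphism (\<lambda>x. g (f x))"
  by (simp add: morphism_def)

lemma morphism_poly: "morphism (\<lambda>t. poly t x)"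
  by unfold_locales simp_all

lemma morphism_const: "morphism (\<lambda>c. [:c:])"
  by unfold_locales (simp_all add: one_pCons)

lemma morphism_pcompose: "morphism (\<lambda>t. pcompose t u)"
  by unfold_locales (simp_all add: pcompose_add pcompose_mult one_pCons pcompose_const)

lemma morphism_poly_map: "morphism f \<Longrightarrow> morphism (\<lambda>t. poly (map_poly f t) x)"
  by (intro morphism_comp[OF morphism.map_poly_morphism morphism_poly])

locale derivation =
  fixes D :: "'a::idom \<Rightarrow> 'a"
  assumes add: "D (u + v) = D u + D v"
    and mult: "D (u * v) = u * D v + v * D u"
begin

lemma zero: "D 0 = 0"
  using add[of 0 0] by (metis add_0_left add_right_cancel)

lemma one: "D 1 = 0"
  using mult[of 1 1] by (metis mult_1_left add_right_cancel add_0_left)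

lemma minus: "D (- u) = - D u"
  using add[of u "- u"] zero by (simp add: eq_neg_iff_add_eq_0 add.commute)

lemma diff: "D (u - v) = D u - D v"
  using add[of u "- v"] minus by simp

lemma sum: "D (sum g A) = (\<Sum>i\<in>A. D (g i))"
  by (induction A rule: infinite_finite_induct) (simp_all add: zero add)

lemma power: "D (u ^ Suc n) = of_nat (Suc n) * u ^ n * D u"
  by (induction n) (simp_all add: mult algebra_simps)

lemma power_CHAR: "CHAR('a) > 0 \<Longrightarrow> D (u ^ CHAR('a)) = 0"
  using power[of u "CHAR('a) - 1"] by (simp del: of_nat_Suc)

text \<open>Chain rule, where \<open>f\<close> embeds the coefficients as constants of
  \<open>D\<close>; the Leibniz rule is applied to one factor \<open>x\<close> at a time.\<close>

lemma poly:
  assumes "morphism f" "\<And>c. D (f c) = 0"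
  shows "D (poly (map_poly f t) x) = poly (map_poly f (pderiv t)) x * D x"
proof (induction t)
  case (pCons c t)
  interpret f: morphism f by fact
  interpret m: morphism "\<lambda>t. poly (map_poly f t) x"
    by (intro morphism_poly_map assms)
  have "poly (map_poly f (pCons 0 1)) x = x"
    by (simp add: map_poly_pCons f.zero f.one)
  then have *: "poly (map_poly f (pCons 0 u)) x = x * poly (map_poly f u) x" for u
    by (simp add: map_poly_pCons f.zero)
  show ?case
    using pCons by (simp add: pderiv_pCons map_poly_pCons f.zero * m.add add mult assms(2)
        algebra_simps)
qed (simp add: zero)

lemma map_poly_derivation: "derivation (map_poly D)"
proof
  show "map_poly D (u + v) = map_poly D u + map_poly D v" for u v
    by (intro poly_eqI) (simp add: coeff_map_poly zero add)
  show "map_poly D (u * v) = u * map_poly D v + v * map_poly D u" for u v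
  proof (intro poly_eqI)
    fix n
    have "(\<Sum>i\<le>n. coeff v i * D (coeff u (n - i))) = (\<Sum>i\<le>n. coeff v (n - i) * D (coeff u i))"
      by (rule sum.reindex_bij_witness[of _ "\<lambda>i. n - i" "\<lambda>i. n - i"]) auto
    then show "coeff (map_poly D (u * v)) n = coeff (u * map_poly D v + v * map_poly D u) n"
      by (simp add: coeff_map_poly zero coeff_mult sum mult sum.distrib)
  qed
qed

end

lemma derivation_pderiv: "derivation (pderiv :: 'a::idom poly \<Rightarrow> 'a poly)"
  by unfold_locales (simp_all add: pderiv_add pderiv_mult)

section \<open>The polynomial ring in two variables\<close>

lemma morphism_cR: "morphism cR"
  unfolding cR_def using morphism_comp[OF morphism_const morphism_const] .

lemma morphism_evalY: "morphism (\<lambda>t. evalY t u)"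
  unfolding evalY_def by (intro morphism_poly_map morphism_cR)

lemma morphism_eval2: "morphism (\<lambda>u. eval2 u P Q)"
  unfolding eval2_def by (intro morphism_poly_map morphism_cR)

lemma evalY_pCons: "evalY (pCons c t) u = cR c + u * evalY t u"
  by (simp add: evalY_def map_poly_pCons cR_def)

lemma evalY_0 [simp]: "evalY 0 u = 0"
  by (simp add: evalY_def)

lemma evalY_Yv: "evalY t Yv = [:t:]"
  by (induction t) (simp_all add: evalY_pCons cR_def Yv_def)

lemma eval2_cR [simp]: "eval2 (cR c) P Q = cR c"
  by (simp add: eval2_def cR_def map_poly_pCons)

lemma eval2_Xv [simp]: "eval2 Xv (P :: 'a::idom poly poly) Q = P"
  by (simp add: eval2_def Xv_def map_poly_pCons morphism.one[OF morphism_cR])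

lemma eval2_Yv [simp]: "eval2 Yv P (Q :: 'a::idom poly poly) = Q"
  by (simp add: eval2_def Yv_def map_poly_pCons morphism.zero[OF morphism_cR] morphism.one[OF morphism_cR])

lemma eval2_const: "eval2 [:t:] P Q = evalY t Q"
  by (simp add: eval2_def evalY_def map_poly_pCons)

lemma evalY_morphism:
  fixes f :: "'a::idom poly poly \<Rightarrow> 'a poly poly"
  assumes "morphism f" "\<And>c. f (cR c) = cR c"
  shows "f (evalY t u) = evalY t (f u)"
proof -
  interpret morphism f by fact
  show ?thesis
    by (induction t) (simp_all add: zero evalY_pCons add mult assms(2))
qed


text \<open>Used as an induction rule: identities of morphisms and Leibniz-type claims need checking
  on constants and the two variables only.\<close>

lemma poly2_generated:
  fixes Q :: "'a::idom poly poly \<Rightarrow> bool"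
  assumes "\<And>c. Q (cR c)" "Q Xv" "Q Yv"
    and add: "\<And>u v. Q u \<Longrightarrow> Q v \<Longrightarrow> Q (u + v)"
    and mult: "\<And>u v. Q u \<Longrightarrow> Q v \<Longrightarrow> Q (u * v)"
  shows "Q u"
proof (induction u)
  case 0
  show ?case using assms(1)[of 0] by (simp add: cR_def)
next
  case (pCons t u)
  have "Q [:t:]"
  proof (induction t)
    case 0
    show ?case using assms(1)[of 0] by (simp add: cR_def)
  next
    case (pCons c t)
    have "[:pCons c t:] = cR c + Yv * [:t:]"
      by (simp add: cR_def Yv_def)
    then show ?case using pCons assms by metis
  qed
  moreover have "pCons t u = [:t:] + Xv * u"
    by (simp add: Xv_def)
  ultimately show ?case using pCons assms by metis
qed

section \<open>Prime characteristic\<close>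

lemma fermat_CHAR:
  assumes "prime CHAR('a::comm_ring_1)"
  shows "(of_nat i :: 'a) ^ CHAR('a) = of_nat i"
proof (induction i)
  case 0
  then show ?case using assms by (simp add: power_0_left prime_gt_0_nat)
next
  case (Suc i)
  then show ?case using freshmans_dream[OF assms refl, of 1 "of_nat i"] by simp
qed

lemma of_nat_unit_CHAR:
  assumes "prime CHAR('a::comm_ring_1)" "\<not> CHAR('a) dvd n"
  obtains j where "of_nat j * (of_nat n :: 'a) = 1"
proof -
  have "coprime n CHAR('a)"
    using assms by (metis coprime_commute prime_imp_coprime)
  then obtain j where "[n * j = 1] (mod CHAR('a))"
    using cong_solve_coprime_nat by auto
  then have "(of_nat (n * j) :: 'a) = of_nat 1"
    by (subst of_nat_eq_iff_cong_CHAR)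
  then show ?thesis using that[of j] by (simp add: mult.commute)
qed

lemma morphism_frobenius:
  assumes "prime CHAR('a::idom)"
  shows "morphism (\<lambda>c::'a. c ^ CHAR('a))"
  by unfold_locales (simp_all add: freshmans_dream[OF assms refl] power_mult_distrib)

lemma poly_power_CHAR:
  assumes "prime CHAR('a::idom)"
  shows "poly t (x::'a) ^ CHAR('a) = poly (map_poly (\<lambda>c. c ^ CHAR('a)) t) (x ^ CHAR('a))"
  by (rule morphism.poly[OF morphism_frobenius[OF assms]])

text \<open>If p does not divide \<open>i\<close>, then \<open>i\<close> is invertible, so
  \<open>l\<close> divides the coefficient of \<open>y ^ i\<close> itself; the other monomials are
  powers of \<open>y ^ p\<close>. The case \<open>l = 0\<close> describes the polynomials with zero
  derivative.\<close>

lemma dvd_pderivE: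
  fixes t :: "'a::idom poly"
  assumes "prime CHAR('a)" "[:l:] dvd pderiv t"
  obtains t1 t2 where "t = pcompose t1 (monom 1 CHAR('a)) + smult l t2"
proof -
  let ?p = "CHAR('a)"
  define Q where "Q = (\<lambda>t. \<exists>t1 t2. t = pcompose t1 (monom 1 ?p) + smult l t2)"
  have Q_add: "Q (u + v)" if uv: "Q u" "Q v" for u v
  proof -
    from uv obtain u1 u2 v1 v2 where "u = pcompose u1 (monom 1 ?p) + smult l u2"
      "v = pcompose v1 (monom 1 ?p) + smult l v2" unfolding Q_def by blast
    then have "u + v = pcompose (u1 + v1) (monom 1 ?p) + smult l (u2 + v2)"
      by (simp add: pcompose_add smult_add_right)
    then show ?thesis unfolding Q_def by blast
  qed
  have Q_monom: "Q (monom (coeff t i) i)" for i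
  proof (cases "?p dvd i")
    case True
    then obtain j where j: "i = ?p * j" by blast
    have "pcompose (smult c (monom 1 j)) (monom 1 ?p) = monom c i"
      for c :: 'a unfolding j monom_altdef[of c] monom_altdef[of 1 j]
      by (simp add: pcompose_smult morphism.power[OF morphism_pcompose] pcompose_pCons
          monom_altdef power_mult)
    then have "monom (coeff t i) i = pcompose (smult (coeff t i) (monom 1 j)) (monom 1 ?p) + smult l 0"
      by simp
    then show ?thesis unfolding Q_def by blast
  next
    case False
    then obtain k where i: "i = Suc k" by (cases i) auto
    from False obtain j where j: "of_nat j * (of_nat i :: 'a) = 1"
      using of_nat_unit_CHAR[OF assms(1)] by blast
    from assms(2) obtain v where "pderiv t = smult l v" by (auto simp: dvd_def)
    then have "of_nat i * coeff t i = l * coeff v k"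
      by (metis coeff_pderiv coeff_smult i)
    then have "of_nat j * of_nat i * coeff t i = l * (of_nat j * coeff v k)"
      by (simp add: algebra_simps)
    then have "coeff t i = l * (of_nat j * coeff v k)" using j by simp
    then have "monom (coeff t i) i = pcompose 0 (monom 1 ?p) + smult l (monom (of_nat j * coeff v k) i)"
      by (simp add: smult_monom)
    then show ?thesis unfolding Q_def by blast
  qed
  have "Q (\<Sum>i\<in>A. monom (coeff t i) i)" if "finite A" for A
    using that
  proof (induction A rule: finite_induct)
    case empty
    show ?case unfolding Q_def by (intro exI[of _ 0]) simp
  qed (simp add: Q_add Q_monom)
  from this[of "{..degree t}"] show ?thesis
    using that unfolding Q_def by (auto simp: poly_as_sum_of_monoms)
qed

lemma taylor1:
  fixes t :: "'a::idom poly"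
  obtains w where "poly t (x + e) = poly t x + e * w"
proof -
  have "\<exists>w. poly t (x + e) = poly t x + e * w"
  proof (induction t)
    case (pCons c t)
    then obtain w where w: "poly t (x + e) = poly t x + e * w" by blast
    show ?case
      by (intro exI[of _ "poly t x + (x + e) * w"]) (simp only: poly_pCons w, simp add: algebra_simps)
  qed (auto intro: exI[of _ 0])
  then show ?thesis using that by blast
qed

lemma taylor2:
  fixes t :: "'a::idom poly"
  obtains w where "poly t (x + e) = poly t x + e * poly (pderiv t) x + e\<^sup>2 * w"
proof -
  have "\<exists>w. poly t (x + e) = poly t x + e * poly (pderiv t) x + e\<^sup>2 * w"
  proof (induction t)
    case (pCons c t)
    then obtain w where w: "poly t (x + e) = poly t x + e * poly (pderiv t) x + e\<^sup>2 * w" by blast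
    show ?case
      by (intro exI[of _ "poly (pderiv t) x + (x + e) * w"])
        (simp only: poly_pCons w pderiv_pCons, simp add: algebra_simps power2_eq_square)
  qed (auto intro: exI[of _ 0])
  then show ?thesis using that by blast
qed

text \<open>Modulo \<open>T ^ p - T\<close> the monomials \<open>T ^ m\<close> with \<open>m \<ge> 1\<close> and \<open>m \<equiv> 1 mod p - 1\<close>
  all become \<open>T\<close>, so the sum below is the coefficient of \<open>T\<close> in the reduction of \<open>G\<close>.\<close>

lemma vanishing_on_prime_field:
  fixes G :: "'a::idom poly"
  assumes p: "prime CHAR('a)" and G: "\<And>i. poly G (of_nat i) = 0" and N: "degree G \<le> N"
  shows "(\<Sum>m | m \<in> {1..N} \<and> (CHAR('a) - 1) dvd (m - 1). coeff G m) = 0"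
proof -
  let ?p = "CHAR('a)"
  \<comment> \<open>\<open>red m\<close> is the exponent of \<open>T ^ m\<close> after reduction: 0
    is kept apart, and positive exponents go to 1, ..., p - 1.\<close>
  define red where "red m = (if m = 0 then 0 else (m - 1) mod (?p - 1) + 1)" for m
  define H where "H = (\<Sum>m\<le>N. monom (coeff G m) (red m))"
  have p2: "?p \<ge> 2" using p prime_ge_2_nat by blast
  have pow: "(of_nat i :: 'a) ^ m = of_nat i ^ red m" for i m
  proof (cases "m = 0")
    case False
    let ?x = "of_nat i :: 'a"
    obtain n where n: "?p = Suc n" using p2 by (cases ?p) auto
    have x: "?x ^ (Suc c + n * k) = ?x ^ Suc c" for k c
    proof (induction k)
      case (Suc k)
      have "?x ^ (Suc c + n * Suc k) = ?x ^ (Suc c + n * k) * ?x ^ n"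
        by (simp add: algebra_simps flip: power_add)
      also have "\<dots> = ?x ^ c * ?x ^ Suc n" by (simp only: Suc) simp
      also have "\<dots> = ?x ^ Suc c" by (simp add: fermat_CHAR[OF p, unfolded n] del: power_Suc) simp
      finally show ?case .
    qed simp
    have "m = red m + (?p - 1) * ((m - 1) div (?p - 1))"
      using False by (simp add: red_def)
    then show ?thesis using x[of "(m - 1) mod (?p - 1)" "(m - 1) div (?p - 1)"] False
      by (simp add: red_def n)
  qed (simp add: red_def)
  have H0: "poly H (of_nat i) = 0" for i
  proof -
    have "poly H (of_nat i) = (\<Sum>m\<le>N. coeff G m * of_nat i ^ m)"
      by (simp add: H_def poly_sum poly_monom flip: pow)
    also have "\<dots> = (\<Sum>m\<le>degree G. coeff G m * of_nat i ^ m)"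
      using N by (intro sum.mono_neutral_right) (auto simp: coeff_eq_0)
    also have "\<dots> = poly G (of_nat i)"
      by (simp add: poly_altdef)
    finally show ?thesis using G by simp
  qed
  \<comment> \<open>The reduced polynomial has degree at most p - 1 but vanishes at the p distinct
    elements of the prime field.\<close>
  have "H = 0"
  proof (rule ccontr)
    assume "H \<noteq> 0"
    have "red m < ?p" for m
    proof -
      have "(m - 1) mod (?p - 1) < ?p - 1" using p2 by (intro mod_less_divisor) simp
      then show ?thesis using p2 unfolding red_def by (auto simp: less_diff_conv)
    qed
    then have "degree (monom (coeff G m) (red m)) \<le> ?p - 1" for m
      using degree_monom_le[of "coeff G m" "red m"] p2 by (smt (verit) Suc_leI diff_Suc_1 diff_le_mono le_trans)
    then have "degree H \<le> ?p - 1"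
      unfolding H_def by (intro degree_sum_le) auto
    moreover have "?p \<le> card {x. poly H x = 0}"
    proof -
      have "inj_on (of_nat :: nat \<Rightarrow> 'a) {..<?p}"
        by (auto simp: inj_on_def of_nat_eq_iff_cong_CHAR cong_def)
      then have "?p = card ((of_nat :: nat \<Rightarrow> 'a) ` {..<?p})" by (simp add: card_image)
      also have "\<dots> \<le> card {x. poly H x = 0}"
        using H0 poly_roots_finite[OF \<open>H \<noteq> 0\<close>] by (intro card_mono) auto
      finally show ?thesis .
    qed
    moreover have "card {x. poly H x = 0} \<le> degree H"
      using \<open>H \<noteq> 0\<close> by (rule card_poly_roots_bound)
    ultimately show False using p2 by linarith
  qed
  then have "0 = coeff H 1" by simp
  also have "\<dots> = (\<Sum>m\<le>N. if red m = 1 then coeff G m else 0)"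
    by (simp add: H_def coeff_sum)
  also have "\<dots> = (\<Sum>m | m \<in> {..N} \<and> red m = 1. coeff G m)"
    by (rule sum.inter_filter[symmetric]) simp
  also have "{m. m \<in> {..N} \<and> red m = 1} = {m. m \<in> {1..N} \<and> (?p - 1) dvd (m - 1)}"
    by (auto simp: red_def dvd_eq_mod_eq_0)
  finally show ?thesis by simp
qed

section \<open>Unique factorization\<close>

text \<open>Says that \<open>w\<close> is a nonzerodivisor modulo \<open>r\<close>. In this form
  coprimality passes to products in \<open>r\<close> by mere cancellation, also in R[x, y].\<close>

definition no_common_factor :: "'a::idom \<Rightarrow> 'a \<Rightarrow> bool" where
  "no_common_factor r w \<longleftrightarrow> r \<noteq> 0 \<and> (\<forall>k. r dvd k * w \<longrightarrow> r dvd k)"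

lemma no_common_factorD: "no_common_factor r w \<Longrightarrow> r dvd k * w \<Longrightarrow> r dvd k"
  unfolding no_common_factor_def by blast

lemma no_common_factor_unit: "r dvd 1 \<Longrightarrow> no_common_factor r w"
  unfolding no_common_factor_def using dvd_trans[of r 1] by (metis dvd_0_left one_dvd zero_neq_one)

lemma no_common_factor_prime: "prime_elem l \<Longrightarrow> \<not> l dvd w \<Longrightarrow> no_common_factor l w"
  unfolding no_common_factor_def by (metis prime_elem_dvd_multD prime_elem_not_zeroI prime_elem_def)

lemma no_common_factor_mult:
  assumes "no_common_factor r w" "no_common_factor r' w"
  shows "no_common_factor (r * r') w"
proof -
  have 0: "r \<noteq> 0" "r' \<noteq> 0" using assms unfolding no_common_factor_def by blast+
  have "r * r' dvd k" if *: "r * r' dvd k * w" for k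
  proof -
    from * have "r dvd k * w" by (rule dvd_mult_left)
    then obtain k' where k': "k = r * k'" using no_common_factorD[OF assms(1)] unfolding dvd_def by blast
    with * 0 have "r' dvd k' * w" by (simp add: mult.assoc)
    then have "r' dvd k'" by (rule no_common_factorD[OF assms(2)])
    then show ?thesis by (simp add: k' mult_dvd_mono)
  qed
  with 0 show ?thesis unfolding no_common_factor_def by (metis mult_eq_0_iff)
qed

lemma no_common_factor_power: "no_common_factor r w \<Longrightarrow> no_common_factor (r ^ n) w"
  by (induction n) (simp_all add: no_common_factor_unit no_common_factor_mult)

lemma prod_list_remove1:
  "l \<in> set ps \<Longrightarrow> prod_list ps = (l :: 'a::comm_monoid_mult) * prod_list (remove1 l ps)"
  by (induction ps) (auto simp: mult.left_commute)

lemma ufd_prime_factorization: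
  assumes "ufd TYPE('a::idom)" "(a::'a) \<noteq> 0"
  shows "\<exists>c ps. a = c * prod_list ps \<and> c dvd 1 \<and> (\<forall>l\<in>set ps. prime_elem l)"
proof (cases "a dvd 1")
  case True
  then show ?thesis by (intro exI[of _ a] exI[of _ "[]"]) simp
next
  case False
  note ufd = assms(1)[unfolded ufd_def]
  from False assms(2) obtain ps where ps: "\<forall>l\<in>set ps. irred l" "a = prod_list ps"
    using ufd[THEN conjunct1, rule_format, of a] by auto
  have "prime_elem l" if "irred l" for l :: 'a
    using ufd[THEN conjunct2, rule_format, OF that] unfolding prim_def prime_elem_def .
  with ps show ?thesis by (intro exI[of _ 1] exI[of _ ps]) simp
qed

text \<open>\<open>d\<close> is the greatest common divisor of \<open>a\<close> and the derivative of \<open>t\<close>.\<close>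

lemma split_off_gcd:
  fixes t :: "'a::idom poly"
  assumes p: "prime CHAR('a)" and "ufd TYPE('a)" and "a \<noteq> 0"
  obtains d c ps t1 t2 where "a = d * (c * prod_list ps)" "c dvd 1"
    "t = pcompose t1 (monom 1 CHAR('a)) + smult d t2"
    "\<forall>l\<in>set ps. prime_elem l \<and> \<not> [:l:] dvd pderiv t2"
proof -
  let ?p = "CHAR('a)"
  obtain c ps0 where c: "a = c * prod_list ps0" "c dvd 1" and ps0: "\<forall>l\<in>set ps0. prime_elem l"
    using ufd_prime_factorization[OF assms(2,3)] by blast
  have "\<exists>d ps t1 t2. prod_list ps0 = d * prod_list ps \<and>
      t = pcompose t1 (monom 1 ?p) + smult d t2 \<and>
      (\<forall>l\<in>set ps. prime_elem l \<and> \<not> [:l:] dvd pderiv t2)"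
    using ps0
  proof (induction "length ps0" arbitrary: ps0 t rule: less_induct)
    case less
    show ?case
    proof (cases "\<exists>l\<in>set ps0. [:l:] dvd pderiv t")
      case False
      then show ?thesis using less.prems
        by (intro exI[of _ 1] exI[of _ ps0] exI[of _ 0] exI[of _ t]) auto
    next
      case True
      \<comment> \<open>A prime of the list that divides the derivative moves into \<open>d\<close>;
        the part of \<open>t\<close> outside \<open>y ^ p\<close> is divided by it, and induction
        treats the shorter list.\<close>
      then obtain l where l: "l \<in> set ps0" "[:l:] dvd pderiv t" by blast
      obtain t1 t2 where t: "t = pcompose t1 (monom 1 ?p) + smult l t2"
        using dvd_pderivE[OF p l(2)] by blast
      have "length (remove1 l ps0) < length ps0"
        using length_pos_if_in_set[OF l(1)] l(1) by (simp add: length_remove1)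
      moreover have "\<forall>l\<in>set (remove1 l ps0). prime_elem l"
        using less.prems set_remove1_subset[of l ps0] by blast
      ultimately have "\<exists>d qs t1 t2'. prod_list (remove1 l ps0) = d * prod_list qs \<and>
          t2 = pcompose t1 (monom 1 ?p) + smult d t2' \<and>
          (\<forall>l\<in>set qs. prime_elem l \<and> \<not> [:l:] dvd pderiv t2')"
        by (rule less.hyps)
      then obtain d ps t1' t2' where *: "prod_list (remove1 l ps0) = d * prod_list ps"
        "t2 = pcompose t1' (monom 1 ?p) + smult d t2'"
        "\<forall>l\<in>set ps. prime_elem l \<and> \<not> [:l:] dvd pderiv t2'"
        by blast
      have "prod_list ps0 = l * prod_list (remove1 l ps0)"
        using l(1) by (rule prod_list_remove1)
      then have "prod_list ps0 = l * d * prod_list ps"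
        by (simp add: *(1) mult.assoc)
      moreover have "t = pcompose (t1 + smult l t1') (monom 1 ?p) + smult (l * d) t2'"
        by (simp add: t *(2) pcompose_add pcompose_smult smult_add_right)
      ultimately show ?thesis using *(3) by blast
    qed
  qed
  then obtain d ps t1 t2 where "prod_list ps0 = d * prod_list ps"
      "t = pcompose t1 (monom 1 ?p) + smult d t2"
      "\<forall>l\<in>set ps. prime_elem l \<and> \<not> [:l:] dvd pderiv t2" by blast
  then show ?thesis using c by (intro that[of d c ps t1 t2]) (simp_all add: mult.left_commute)
qed

section \<open>Dual basis formula\<close>

text \<open>Modulo \<open>w ^ Suc m\<close> only the term in which every \<open>D\<close> hits the
  power of \<open>w\<close> survives; the successive exponents \<open>m + j\<close>, ...,
  \<open>m + 1\<close> multiply to the Pochhammer symbol.\<close>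

lemma (in derivation) iterate_mult_power:
  "\<exists>v. (D ^^ j) (c * w ^ (m + j)) = w ^ m * (pochhammer (of_nat (Suc m)) j * c * D w ^ j) + w ^ Suc m * v"
proof (induction j arbitrary: m)
  case 0
  show ?case by (intro exI[of _ 0]) (simp add: algebra_simps)
next
  case (Suc j)
  define x where "x = pochhammer (of_nat (Suc (Suc m))) j * c * D w ^ j"
  obtain v where v: "(D ^^ j) (c * w ^ (Suc m + j)) = w ^ Suc m * x + w ^ Suc (Suc m) * v"
    using Suc[of "Suc m"] unfolding x_def by blast
  have "(D ^^ Suc j) (c * w ^ (m + Suc j)) = D (w ^ Suc m * x + w ^ Suc (Suc m) * v)"
    using v by simp
  also have "\<dots> = w ^ m * (of_nat (Suc m) * x * D w)
      + w ^ Suc m * (D x + of_nat (Suc (Suc m)) * D w * v + w * D v)"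
    unfolding add mult power by (simp add: algebra_simps)
  also have "of_nat (Suc m) * x * D w = pochhammer (of_nat (Suc m)) (Suc j) * c * D w ^ Suc j"
    by (simp add: x_def pochhammer_rec algebra_simps)
  finally show ?case by blast
qed

text \<open>Coefficients get multiplied by p consecutive integers starting at \<open>n + 1\<close>;
  one of them, \<open>n + 1 + i\<close>, is divisible by p.\<close>

lemma higher_pderiv_CHAR:
  assumes "prime CHAR('a::idom)"
  shows "(pderiv ^^ CHAR('a)) (t :: 'a poly) = 0"
proof (intro poly_eqI)
  fix n
  let ?p = "CHAR('a)"
  define i where "i = ?p - 1 - n mod ?p"
  have p: "?p > 0" using assms prime_gt_0_nat by blast
  have "Suc n + i = Suc (n mod ?p + i) + n div ?p * ?p"
    using div_mult_mod_eq[of n ?p] by linarith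
  also have "Suc (n mod ?p + i) = ?p"
    using mod_less_divisor[OF p, of n] by (simp add: i_def)
  finally have "?p dvd Suc n + i" by simp
  then have "(of_nat (Suc n + i) :: 'a) = 0" by (simp only: of_nat_eq_0_iff_char_dvd)
  then have *: "(of_nat (Suc n) :: 'a) + of_nat i = 0" by (simp only: of_nat_add)
  have "i < ?p" using p by (simp add: i_def)
  then have "pochhammer (of_nat (Suc n)) ?p = (0 :: 'a)"
    unfolding pochhammer_prod using * by (intro prod_zero) auto
  then show "coeff ((pderiv ^^ ?p) t) n = coeff 0 n"
    by (simp add: coeff_higher_pderiv)
qed

lemma coeff_map_pderiv_iterate:
  "coeff ((map_poly pderiv ^^ j) v) m = (pderiv ^^ j) (coeff v m)"
  for v :: "'a::idom poly poly"
  by (induction j arbitrary: v) (simp_all add: coeff_map_poly funpow_swap1)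

text \<open>The coefficients of \<open>\<partial> ^ (p - 1) (h * (T - t) ^ (p - 1))\<close>, where \<open>\<partial> = d/dy\<close> acts on the
  coefficients of a polynomial in \<open>T\<close>, are polynomials in \<open>y ^ p\<close> as \<open>\<partial> ^ p = 0\<close>, and its value
  at \<open>T = t\<close> is \<open>(p - 1)! * h * (- t') ^ (p - 1)\<close>.\<close>

lemma mult_pderiv_power_in_subring:
  fixes t :: "'a::idom poly"
  assumes p: "prime CHAR('a)"
  obtains Th :: "'a poly poly"
    where "poly (map_poly (\<lambda>k. pcompose k (monom 1 CHAR('a))) Th) t = h * pderiv t ^ (CHAR('a) - 1)"
proof -
  let ?p = "CHAR('a)"
  define D :: "'a poly poly \<Rightarrow> 'a poly poly" where "D = map_poly pderiv"
  interpret D: derivation D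
    unfolding D_def by (intro derivation.map_poly_derivation derivation_pderiv)
  obtain n where n: "?p = Suc n" using p by (metis not0_implies_Suc not_prime_0)
  have "\<not> ?p dvd fact n"
    using p n by (simp add: prime_dvd_fact_iff)
  then obtain j where j: "of_nat j * (of_nat (fact n) :: 'a) = 1"
    using of_nat_unit_CHAR[OF p] by blast
  have neg: "(- q) ^ k = smult ((-1) ^ k) (q ^ k)" for q :: "'a poly" and k
    by (induction k) simp_all
  have nat: "of_nat k * q = smult (of_nat k) q" for q :: "'a poly" and k
    by (simp add: of_nat_poly)
  \<comment> \<open>The scalar cancels the factor (p - 1)! (-1) ^ (p - 1) produced by iterating the
    derivation; \<open>j\<close> inverts (p - 1)!.\<close>
  define c where "c = [: smult ((-1) ^ n * of_nat j) h :]"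
  define w where "w = [:- t, 1:]"
  define v where "v = (D ^^ n) (c * w ^ n)"
  have Dw: "D w = [:- pderiv t:]"
    by (simp add: D_def w_def map_poly_pCons pderiv_minus)
  obtain x where "v = pochhammer (of_nat (Suc 0)) n * c * D w ^ n + w * x"
    using D.iterate_mult_power[of n c w 0] unfolding v_def by auto
  moreover have "pochhammer (of_nat (Suc 0)) n = (of_nat (fact n) :: 'a poly poly)"
    by (simp only: pochhammer_of_nat) (simp add: pochhammer_fact)
  ultimately have "poly v t = poly (of_nat (fact n) * c * D w ^ n) t"
    by (simp add: w_def)
  also have "\<dots> = of_nat (fact n) * smult ((-1) ^ n * of_nat j) h * (- pderiv t) ^ n"
    by (simp add: Dw c_def ac_simps)
  also have "\<dots> = smult (of_nat j * of_nat (fact n) * ((-1) ^ n * (-1) ^ n)) (h * pderiv t ^ n)"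
    by (simp only: neg nat mult_smult_left mult_smult_right smult_smult) (simp only: ac_simps)
  also have "\<dots> = h * pderiv t ^ n"
    unfolding j by (simp flip: power_mult_distrib)
  finally have v: "poly v t = h * pderiv t ^ n" .
  \<comment> \<open>\<open>k\<close> picks a preimage under the substitution of \<open>y ^ p\<close>
    for \<open>y\<close>. It sends 0 to 0 so that \<open>map_poly\<close> applies it
    coefficientwise.\<close>
  define k where "k = (\<lambda>c :: 'a poly. if c = 0 then 0 else SOME k. c = pcompose k (monom 1 ?p))"
  have k: "pcompose (k (coeff v m)) (monom 1 ?p) = coeff v m" for m
  proof (cases "coeff v m = 0")
    case False
    have "pderiv (coeff v m) = (pderiv ^^ ?p) (coeff (c * w ^ n) m)"
      by (simp add: v_def D_def coeff_map_pderiv_iterate n)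
    then have "[:0:] dvd pderiv (coeff v m)"
      using higher_pderiv_CHAR[OF p] by simp
    then obtain t1 t2 where "coeff v m = pcompose t1 (monom 1 ?p) + smult 0 t2"
      using dvd_pderivE[OF p] by blast
    then have "\<exists>k. coeff v m = pcompose k (monom 1 ?p)" by auto
    from someI_ex[OF this] False show ?thesis by (simp add: k_def)
  qed (simp add: k_def)
  have "map_poly (\<lambda>k. pcompose k (monom 1 ?p)) (map_poly k v) = v"
    by (intro poly_eqI) (simp add: coeff_map_poly k_def k[unfolded k_def])
  then show ?thesis using that[of "map_poly k v"] v n by simp
qed

section \<open>Evaluation and congruences\<close>

lemma evalY_power: "evalY (monom 1 n) u = (u :: 'a::idom poly poly) ^ n"
proof -
  interpret Y: morphism "\<lambda>t. evalY t u" by (rule morphism_evalY)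
  have "monom (1 :: 'a) n = [:0, 1:] ^ n" by (simp add: monom_altdef)
  then show ?thesis
    by (simp add: Y.power)
      (simp add: evalY_pCons morphism.zero[OF morphism_cR] morphism.one[OF morphism_cR] Y.one)
qed

lemma evalY_pcompose: "evalY (pcompose t u) v = evalY t (evalY u (v :: 'a::idom poly poly))"
proof -
  interpret Y: morphism "\<lambda>t. evalY t v" by (rule morphism_evalY)
  show ?thesis
    by (induction t) (simp_all add: pcompose_pCons Y.add Y.mult evalY_pCons cR_def Y.zero)
qed

lemma eval2_dvd_diff:
  fixes c :: "'a::idom poly poly"
  assumes "c dvd P - P'" "c dvd Q - Q'"
  shows "c dvd eval2 u P Q - eval2 u P' Q'"
proof (induction u rule: poly2_generated)
  case (4 u v)
  then show ?case
    using dvd_add[OF 4] by (simp add: morphism.add[OF morphism_eval2] algebra_simps)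
next
  case (5 u v)
  have "eval2 (u * v) P Q - eval2 (u * v) P' Q' =
    eval2 u P Q * (eval2 v P Q - eval2 v P' Q') + eval2 v P' Q' * (eval2 u P Q - eval2 u P' Q')"
    by (simp add: morphism.mult[OF morphism_eval2] algebra_simps)
  then show ?case using 5 by simp
qed (use assms in simp_all)

lemma evalY_dvd_diff: "c dvd Q - Q' \<Longrightarrow> c dvd evalY t Q - evalY t Q'"
  for c :: "'a::idom poly poly"
  using eval2_dvd_diff[of c 0 0 Q Q' "[:t:]"] by (simp add: eval2_const)

lemma eval2_morphism:
  fixes f :: "'a::idom poly poly \<Rightarrow> 'a poly poly"
  assumes "morphism f" "\<And>c. f (cR c) = cR c"
  shows "f (eval2 u P Q) = eval2 u (f P) (f Q)"
proof (induction u rule: poly2_generated)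
qed (simp_all add: assms(2) morphism.add[OF morphism_eval2] morphism.mult[OF morphism_eval2]
    morphism.add[OF assms(1)] morphism.mult[OF assms(1)])

text \<open>By the chain rule the derivative is a combination of \<open>D P\<close> and
  \<open>D Q\<close>.\<close>

lemma derivation_dvd_eval2:
  fixes c :: "'a::idom poly poly"
  assumes "derivation D" "\<And>z. D (cR z) = 0" "c dvd D P" "c dvd D Q"
  shows "c dvd D (eval2 u P Q)"
proof -
  interpret derivation D by fact
  show ?thesis
  proof (induction u rule: poly2_generated)
    case (4 u v)
    then show ?case by (simp add: morphism.add[OF morphism_eval2] add)
  next
    case (5 u v)
    then show ?case by (simp add: morphism.mult[OF morphism_eval2] mult)
  qed (use assms in simp_all)
qed

lemma derivation_evalY:
  fixes D :: "'a::idom poly poly \<Rightarrow> 'a poly poly"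
  assumes "derivation D" "\<And>z. D (cR z) = 0"
  shows "D (evalY t u) = evalY (pderiv t) u * D u"
  unfolding evalY_def by (rule derivation.poly[OF assms(1) morphism_cR assms(2)])

section \<open>The Jacobian\<close>

definition dx :: "'a::idom poly poly \<Rightarrow> 'a poly poly" where "dx = pderiv"

definition dy :: "'a::idom poly poly \<Rightarrow> 'a poly poly" where "dy = map_poly pderiv"

definition jac :: "'a::idom poly poly \<Rightarrow> 'a poly poly \<Rightarrow> 'a poly poly" where
  "jac u v = dx u * dy v - dy u * dx v"

lemma derivation_dx: "derivation dx"
  unfolding dx_def by (rule derivation_pderiv)

lemma derivation_dy: "derivation dy"
  unfolding dy_def by (intro derivation.map_poly_derivation derivation_pderiv)

lemma dx_const [simp]: "dx [:t:] = 0"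
  by (simp add: dx_def)

lemma dy_const [simp]: "dy [:t:] = [:pderiv t:]"
  by (simp add: dy_def map_poly_pCons)

lemma dx_cR [simp]: "dx (cR c) = 0" and dy_cR [simp]: "dy (cR c) = 0"
  by (simp_all add: cR_def)

lemma dx_Xv [simp]: "dx Xv = 1" and dy_Xv [simp]: "dy Xv = 0"
  by (simp_all add: Xv_def dx_def dy_def pderiv_pCons map_poly_pCons)

lemma dx_Yv [simp]: "dx Yv = 0" and dy_Yv [simp]: "dy Yv = 1"
  by (simp_all add: Yv_def dx_def dy_def pderiv_pCons map_poly_pCons one_pCons)

lemma derivation_jac: "derivation (jac u)"
  unfolding jac_def
  by unfold_locales
    (simp_all add: derivation.add[OF derivation_dx] derivation.add[OF derivation_dy]
      derivation.mult[OF derivation_dx] derivation.mult[OF derivation_dy] algebra_simps)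

lemma jac_cR [simp]: "jac u (cR c) = 0"
  by (simp add: jac_def)

lemma jac_self [simp]: "jac u u = 0"
  by (simp add: jac_def)

lemma jac_swap: "jac u v = - jac v u"
  by (simp add: jac_def)

section \<open>Invariants of the automorphism\<close>

lemma Yv_const: "Yv = [:[:0, 1:]:]"
  by (simp add: Yv_def)

text \<open>The situation after \<open>split_off_gcd\<close>, with \<open>r\<close> and
  \<open>th2\<close> the parts left of \<open>a\<close> and \<open>th\<close>. That no prime divides
  both \<open>r\<close> and the derivative of \<open>th2\<close> enters later, through the premise
  \<open>coprime\<close> of \<open>ideal_is_unit_ideal\<close>.\<close>

locale nagata =
  fixes a :: "'a::idom" and th :: "'a poly" and F :: "'a poly poly"
    and d r :: 'a and th1 th2 :: "'a poly" and p :: nat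
  assumes p: "prime p" and char [simp]: "CHAR('a) = p"
    and a_nz: "a \<noteq> 0" and F_nz: "F \<noteq> 0"
    and F_in: "in_Rf F (cR a * Xv + evalY th Yv)"
    and a_def: "a = d * r"
    and th_def: "th = pcompose th1 (monom 1 p) + smult d th2"
begin

definition "\<phi> = phi a th F"
definition "f = cR a * Xv + evalY th Yv"
definition "s = cR d * F"
definition "e = (cR a * F) ^ (p - 1)"
text \<open>The norm of \<open>y\<close> along its orbit, that is the product of
  \<open>y + i a F\<close> over i in F_p.\<close>

definition "q = Yv ^ p - e * Yv"
definition "rr = cR r"
definition "tt = [:pderiv th2:]"

lemma d_nz: "d \<noteq> 0" and r_nz: "r \<noteq> 0"
  using a_nz a_def by auto

lemma cR_eq_0_iff [simp]: "cR c = (0 :: 'a poly poly) \<longleftrightarrow> c = 0"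
  by (simp add: cR_def)

lemma s_nz: "s \<noteq> 0" and rr_nz: "rr \<noteq> 0"
  using d_nz r_nz F_nz by (simp_all add: s_def rr_def)

lemma cR_a: "cR a = cR d * rr"
  by (simp add: a_def rr_def cR_def)

lemma p2: "p \<ge> 2"
  using p prime_ge_2_nat by blast

lemma p_Suc: "p = Suc (Suc (p - 2))" "p - 1 = Suc (p - 2)"
  using p2 by simp_all

lemma freshman: "(u + v) ^ p = u ^ p + (v :: 'a poly poly) ^ p"
  by (rule freshmans_dream) (simp_all add: p)

lemma morphism_phi: "morphism \<phi>"
  unfolding \<phi>_def phi_def[abs_def] by (rule morphism_eval2)

sublocale phi: morphism \<phi>
  by (rule morphism_phi)

lemma phi_cR: "\<phi> (cR c) = cR c"
  by (simp add: \<phi>_def phi_def)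

lemma phi_Yv: "\<phi> Yv = Yv + cR a * F"
  by (simp add: \<phi>_def phi_def)

lemma phi_f: "\<phi> f = f"
proof -
  obtain w where w: "evalY th (Yv + cR a * F) = evalY th Yv + cR a * F * w"
    using taylor1[of "map_poly cR th" Yv "cR a * F"] unfolding evalY_def by blast
  \<comment> \<open>\<open>phi_xpart\<close> is a definite description, so the quotient must be
    shown to exist, by Taylor expansion, and to be unique, by cancelling \<open>a\<close>.\<close>
  have "\<exists>!q. cR a * q = evalY th Yv - evalY th (Yv + cR a * F)"
  proof (rule ex1I)
    show "cR a * (- F * w) = evalY th Yv - evalY th (Yv + cR a * F)"
      by (simp add: w)
    show "q = - F * w" if "cR a * q = evalY th Yv - evalY th (Yv + cR a * F)" for q
    proof -
      have "cR a * q = cR a * (- F * w)" using that by (simp add: w)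
      then show ?thesis using a_nz by (metis cR_eq_0_iff mult_left_cancel)
    qed
  qed
  from theI'[OF this] have "cR a * phi_xpart a th F = evalY th Yv - evalY th (Yv + cR a * F)"
    unfolding phi_xpart_def .
  moreover have "\<phi> Xv = Xv + phi_xpart a th F"
    by (simp add: \<phi>_def phi_def)
  ultimately show ?thesis
    by (simp add: f_def phi.add phi.mult phi_cR evalY_morphism[OF morphism_phi phi_cR] phi_Yv
        algebra_simps)
qed

lemma phi_F: "\<phi> F = F"
proof -
  obtain Ft where Ft: "F = evalY Ft f" using F_in unfolding in_Rf_def f_def[symmetric] by blast
  have "\<phi> (evalY Ft f) = evalY Ft f"
    by (simp only: evalY_morphism[OF morphism_phi phi_cR] phi_f)
  then show ?thesis by (simp only: Ft[symmetric])
qed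

lemma phi_e: "\<phi> e = e"
  by (simp add: e_def phi.power phi.mult phi_cR phi_F)

lemma e_mult: "e * (cR a * F) = (cR a * F) ^ p"
  using power_Suc2[of "cR a * F" "p - 1"] p2 by (simp add: e_def)

text \<open>As the p-th power is additive, \<open>y ^ p\<close> grows by \<open>(a F) ^ p\<close>,
  which is also the growth of \<open>e y\<close>.\<close>

lemma phi_q: "\<phi> q = q"
  using e_mult
  by (simp add: q_def phi.diff phi.mult phi.power phi_Yv phi_e freshman power_mult_distrib
      algebra_simps)

lemma e_rr: "e = rr ^ (p - 1) * s ^ (p - 1)"
  by (simp add: e_def cR_a s_def power_mult_distrib)

lemma rr_e: "rr * e = rr ^ p * s ^ (p - 1)"
  unfolding e_rr using p_Suc by (metis mult.assoc power_Suc)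

lemma rr_dvd_e: "rr dvd e"
  unfolding e_rr using p_Suc(2) by simp

lemma rr_power_dvd_e2: "rr ^ p dvd e\<^sup>2"
proof -
  have "e\<^sup>2 = rr ^ (2 * (p - 1)) * s ^ (2 * (p - 1))"
    by (simp add: e_rr power_mult_distrib mult.commute flip: power_mult)
  moreover have "p \<le> 2 * (p - 1)" using p2 by simp
  ultimately show ?thesis by (simp add: le_imp_power_dvd)
qed

lemma evalY_th: "evalY th u = evalY th1 (u ^ p) + cR d * evalY th2 u"
proof -
  interpret Y: morphism "\<lambda>t. evalY t u" by (rule morphism_evalY)
  have "smult d th2 = [:d:] * th2" by simp
  then have "evalY (smult d th2) u = cR d * evalY th2 u"
    by (simp add: Y.mult evalY_pCons del: mult_pCons_left)
  then show ?thesis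
    unfolding th_def by (simp add: Y.add evalY_pcompose evalY_power)
qed

lemma rr_dvd_q: "rr dvd q - Yv ^ p"
  using rr_dvd_e by (simp add: q_def)

text \<open>Replacing \<open>y ^ p\<close> by \<open>q\<close> inside \<open>th1\<close> costs a
  multiple of \<open>e\<close>, which contains the factor \<open>a = d r\<close>; all other terms of
  \<open>f - th1(q)\<close> come from \<open>a x + d th2\<close>.\<close>

lemma f'_exists: "\<exists>f' f''. f' = [:th2:] + rr * f'' \<and> cR d * f' = f - evalY th1 q"
proof -
  obtain w where "evalY th1 (q + e * Yv) = evalY th1 q + e * Yv * w"
    using taylor1[of "map_poly cR th1" q "e * Yv"] unfolding evalY_def by blast
  then have w: "evalY th1 (Yv ^ p) = evalY th1 q + e * Yv * w"
    by (simp add: q_def)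
  define e' where "e' = (cR a * F) ^ (p - 2) * F"
  have e': "e = cR a * e'"
    unfolding e_def e'_def p_Suc(2) by simp
  have "cR d * ([:th2:] + rr * (Xv + e' * Yv * w)) = f - evalY th1 q"
    unfolding f_def evalY_th w evalY_Yv[of th2] e' cR_a by (simp only: algebra_simps)
  then show ?thesis by blast
qed

definition "f' = (SOME f'. \<exists>f''. f' = [:th2:] + rr * f'' \<and> cR d * f' = f - evalY th1 q)"

lemma f': "\<exists>f''. f' = [:th2:] + rr * f''" "cR d * f' = f - evalY th1 q"
  using someI_ex[OF f'_exists] unfolding f'_def by blast+

lemma phi_f': "\<phi> f' = f'"
proof -
  have "\<phi> (cR d * f') = cR d * f'"
    unfolding f'(2) by (simp add: phi.diff phi_f evalY_morphism[OF morphism_phi phi_cR] phi_q)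
  then show ?thesis using d_nz by (simp add: phi.mult phi_cR)
qed

section \<open>Jacobians of the explicit invariants\<close>

lemma jac_F: "jac f F = 0"
proof -
  obtain Ft where Ft: "F = evalY Ft f" using F_in unfolding in_Rf_def f_def[symmetric] by blast
  have "jac f (evalY Ft f) = 0"
    by (simp only: derivation_evalY[OF derivation_jac jac_cR] jac_self mult_zero_right)
  then show ?thesis by (simp only: Ft[symmetric])
qed

lemma jac_f_Yv: "jac f Yv = cR a"
  by (simp add: jac_def f_def derivation.add[OF derivation_dx] derivation.mult[OF derivation_dx]
      evalY_Yv)

lemma jac_e: "jac u e = of_nat (p - 1) * (cR a * F) ^ (p - 2) * (cR a * jac u F)"
  unfolding e_def p_Suc(2) derivation.power[OF derivation_jac]
  by (simp add: derivation.mult[OF derivation_jac])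

lemma jac_q: "jac u q = - e * jac u Yv - Yv * jac u e"
proof -
  have "jac u (Yv ^ p) = 0"
    using derivation.power_CHAR[OF derivation_jac, of u Yv] p2 by simp
  then show ?thesis
    by (simp add: q_def derivation.diff[OF derivation_jac] derivation.mult[OF derivation_jac])
qed

definition "\<kappa> = rr ^ p * s ^ (p - 1)"

text \<open>\<open>d f'\<close> differs from \<open>f\<close> by a polynomial in \<open>q\<close>,
  so J(f, q) decides; there \<open>e\<close> acts as a constant, since \<open>F\<close> is a
  polynomial in \<open>f\<close>, and J(f, y) = a.\<close>

lemma jac_f'_q: "jac f' q = - \<kappa>"
proof -
  have "cR d * jac q f' = jac q (cR d * f')"
    by (simp add: derivation.mult[OF derivation_jac])
  also have "\<dots> = jac q f"
    by (simp add: f'(2) derivation.diff[OF derivation_jac] derivation_evalY[OF derivation_jac jac_cR])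
  also have "\<dots> = - jac f q" by (rule jac_swap)
  also have "\<dots> = cR d * (rr * e)"
    by (simp add: jac_q jac_f_Yv jac_e jac_F cR_a algebra_simps)
  finally have "jac q f' = \<kappa>" using d_nz by (simp add: rr_e \<kappa>_def)
  then show ?thesis using jac_swap[of f' q] by simp
qed

lemma kappa_dvd_eval2: "\<kappa> dvd jac f' (eval2 u f' q)"
  by (rule derivation_dvd_eval2[OF derivation_jac jac_cR]) (simp_all add: jac_f'_q)

text \<open>\<open>F\<close> is a polynomial in \<open>f = d f' + th1(q)\<close>, hence in
  \<open>f'\<close> and \<open>q\<close>.\<close>

lemma kappa_dvd_F: "\<kappa> dvd jac f' F"
proof -
  obtain Ft where Ft: "F = evalY Ft f" using F_in unfolding in_Rf_def f_def[symmetric] by blast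
  interpret m: morphism "\<lambda>u. eval2 u f' q" by (rule morphism_eval2)
  have E: "eval2 (evalY t u) f' q = evalY t (eval2 u f' q)" for t u
    by (rule evalY_morphism[OF morphism_eval2]) simp
  have "eval2 (evalY Ft (cR d * Xv + evalY th1 Yv)) f' q = evalY Ft (cR d * f' + evalY th1 q)"
    by (simp add: E m.add m.mult)
  also have "\<dots> = evalY Ft f" by (simp add: f'(2))
  also note Ft[symmetric]
  finally show ?thesis
    using kappa_dvd_eval2[of "evalY Ft (cR d * Xv + evalY th1 Yv)"] by (simp only:)
qed

lemma rr_kappa_dvd_e: "rr * \<kappa> dvd jac f' e"
  unfolding jac_e using kappa_dvd_F by (simp add: cR_a mult_dvd_mono)

lemma const_power_p: "[:u:] ^ p = evalY (map_poly (\<lambda>c. c ^ p) u) (Yv ^ p)"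
  for u :: "'a poly"
proof -
  have "[:u:] ^ p = poly (map_poly cR u) Yv ^ p"
    using evalY_Yv[of u] by (simp add: evalY_def)
  also have "\<dots> = poly (map_poly (\<lambda>c. c ^ p) (map_poly cR u)) (Yv ^ p)"
    using poly_power_CHAR[where t = "map_poly cR u" and x = Yv] p by simp
  also have "map_poly (\<lambda>c. c ^ p) (map_poly cR u) = map_poly cR (map_poly (\<lambda>c. c ^ p) u)"
    using p2 by (intro poly_eqI)
      (simp add: coeff_map_poly morphism.zero[OF morphism_cR] morphism.power[OF morphism_cR])
  finally show ?thesis by (simp add: evalY_def)
qed

text \<open>\<open>f' ^ p\<close> agrees with \<open>T(y ^ p)\<close> modulo \<open>r ^ p\<close>,
  where \<open>T\<close> is \<open>th2\<close> with coefficients raised to the p-th power. Taylor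
  expansion of \<open>T\<close> at \<open>q\<close> leaves the term \<open>e y T'(q)\<close>, in
  which \<open>e\<close> accounts for \<open>r ^ (p - 1)\<close>. The dual basis formula supplies
  \<open>Th(f', q)\<close> congruent to \<open>y T'(q)\<close> modulo \<open>r\<close>; subtracting
  \<open>e Th(f', q)\<close> makes everything divisible by \<open>r ^ p\<close>, and
  \<open>g\<close> is the quotient.\<close>

lemma second_invariant:
  obtains g w where "\<phi> g = g" "jac f' g = s ^ (p - 1) * w" "rr dvd w - tt ^ p"
proof -
  let ?Fr = "map_poly (\<lambda>c::'a. c ^ p)"
  define T where "T = ?Fr th2"
  have T': "pderiv T = ?Fr (pderiv th2)"
    unfolding T_def by (rule morphism.pderiv[OF morphism_frobenius[where 'a = 'a, unfolded char, OF p]])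
  \<comment> \<open>The multiplier \<open>h = y t\<close> turns the value into
    \<open>y t ^ p\<close>, which is \<open>y T'(y ^ p)\<close>.\<close>
  obtain Th where Th: "poly (map_poly (\<lambda>k. pcompose k (monom 1 p)) Th) th2 =
      [:0, 1:] * pderiv th2 * pderiv th2 ^ (p - 1)"
    using mult_pderiv_power_in_subring[where 'a = 'a, unfolded char, OF p] by blast
  have eval2_Th: "eval2 u [:t:] (Yv ^ p) = [:poly (map_poly (\<lambda>k. pcompose k (monom 1 p)) u) t:]"
    for u and t :: "'a poly"
  proof (induction u)
    case (pCons k u)
    interpret m: morphism "\<lambda>u. eval2 u [:t:] (Yv ^ p)" by (rule morphism_eval2)
    have "pCons k u = [:k:] + Xv * u" by (simp add: Xv_def)
    then have "eval2 (pCons k u) [:t:] (Yv ^ p) = evalY k (Yv ^ p) + [:t:] * eval2 u [:t:] (Yv ^ p)"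
      by (simp add: m.add m.mult eval2_const)
    also have "evalY k (Yv ^ p) = [:pcompose k (monom 1 p):]"
      by (metis evalY_Yv evalY_pcompose evalY_power)
    finally show ?case using pCons by (simp add: map_poly_pCons)
  qed (simp add: morphism.zero[OF morphism_eval2])
  obtain f'' where f'': "f' = [:th2:] + rr * f''" using f'(1) by blast
  define b where "b = Yv * evalY (pderiv T) q - eval2 Th f' q"
  have "rr dvd b"
  proof -
    have "rr dvd evalY (pderiv T) q - evalY (pderiv T) (Yv ^ p)"
      by (intro evalY_dvd_diff rr_dvd_q)
    moreover have "rr dvd eval2 Th f' q - eval2 Th [:th2:] (Yv ^ p)"
      by (intro eval2_dvd_diff rr_dvd_q) (simp add: f'')
    moreover have "eval2 Th [:th2:] (Yv ^ p) = Yv * evalY (pderiv T) (Yv ^ p)"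
    proof -
      have "eval2 Th [:th2:] (Yv ^ p) = Yv * (tt * tt ^ (p - 1))"
        unfolding eval2_Th Th by (simp add: Yv_const tt_def poly_const_pow)
      also have "tt * tt ^ (p - 1) = tt ^ p"
        using p2 by (metis p_Suc power_Suc)
      finally show ?thesis by (simp add: T' tt_def const_power_p)
    qed
    moreover have "b = Yv * (evalY (pderiv T) q - evalY (pderiv T) (Yv ^ p))
        - (eval2 Th f' q - eval2 Th [:th2:] (Yv ^ p))
        + (Yv * evalY (pderiv T) (Yv ^ p) - eval2 Th [:th2:] (Yv ^ p))"
      by (simp add: b_def algebra_simps)
    ultimately show ?thesis by simp
  qed
  then obtain b' where b': "b = rr * b'" by blast
  obtain v where "evalY T (q + e * Yv) = evalY T q + e * Yv * evalY (pderiv T) q + (e * Yv)\<^sup>2 * v"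
    using taylor2[of "map_poly cR T" q "e * Yv"] unfolding evalY_def
      morphism.pderiv[OF morphism_cR] by blast
  then have v: "evalY T (Yv ^ p) = evalY T q + e * Yv * evalY (pderiv T) q + e\<^sup>2 * (Yv\<^sup>2 * v)"
    by (simp add: q_def power_mult_distrib mult.assoc)
  obtain e2 where e2: "e\<^sup>2 = rr ^ p * e2" using rr_power_dvd_e2 by blast
  define g where "g = f'' ^ p + e2 * (Yv\<^sup>2 * v) + s ^ (p - 1) * b'"
  have "f' ^ p = evalY T (Yv ^ p) + rr ^ p * f'' ^ p"
    by (simp add: f'' freshman power_mult_distrib const_power_p T_def)
  then have "f' ^ p - evalY T q - e * eval2 Th f' q
      = e * b + rr ^ p * (f'' ^ p + e2 * (Yv\<^sup>2 * v))"
    by (simp add: v b_def e2 algebra_simps)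
  also have "e * b = rr ^ p * (s ^ (p - 1) * b')"
    using rr_e by (simp add: b' algebra_simps)
  finally have g: "rr ^ p * g = f' ^ p - evalY T q - e * eval2 Th f' q"
    by (simp add: g_def algebra_simps)
  have "\<phi> (rr ^ p * g) = rr ^ p * g"
    unfolding g
    by (simp add: phi.diff phi.mult phi.power phi_f' phi_e phi_q
        evalY_morphism[OF morphism_phi phi_cR] eval2_morphism[OF morphism_phi phi_cR])
  then have phi_g: "\<phi> g = g"
    using r_nz by (simp add: phi.mult phi.power rr_def phi_cR)
  obtain m1 where m1: "jac f' (eval2 Th f' q) = \<kappa> * m1" using kappa_dvd_eval2 by blast
  obtain m2 where m2: "jac f' e = rr * \<kappa> * m2" using rr_kappa_dvd_e by blast
  obtain m3 where m3: "e = rr * m3" using rr_dvd_e by blast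
  \<comment> \<open>What remains of the Jacobian of \<open>r ^ p g\<close> after removing
    \<open>\<kappa>\<close>; the terms from \<open>e Th(f', q)\<close> contribute multiples of
    \<open>r\<close>.\<close>
  define w where "w = evalY (pderiv T) q - rr * (m3 * m1 + eval2 Th f' q * m2)"
  have "rr ^ p * jac f' g = jac f' (rr ^ p * g)"
    by (simp add: derivation.mult[OF derivation_jac] rr_def flip: morphism.power[OF morphism_cR])
  also have "\<dots> = jac f' (f' ^ p) - evalY (pderiv T) q * jac f' q
      - (e * jac f' (eval2 Th f' q) + eval2 Th f' q * jac f' e)"
    unfolding g by (simp add: derivation.diff[OF derivation_jac] derivation.mult[OF derivation_jac]
        derivation_evalY[OF derivation_jac jac_cR])
  also have "jac f' (f' ^ p) = 0"
    using derivation.power_CHAR[OF derivation_jac, of f' f'] p2 by simp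
  finally have "rr ^ p * jac f' g = rr ^ p * (s ^ (p - 1) * w)"
    unfolding jac_f'_q m1 m2 w_def by (simp add: m3 \<kappa>_def algebra_simps)
  then have jac: "jac f' g = s ^ (p - 1) * w" using rr_nz by simp
  have "rr dvd evalY (pderiv T) q - evalY (pderiv T) (Yv ^ p)"
    by (intro evalY_dvd_diff rr_dvd_q)
  then have "rr dvd (evalY (pderiv T) q - evalY (pderiv T) (Yv ^ p)) - rr * (m3 * m1 + eval2 Th f' q * m2)"
    by (rule dvd_diff) simp
  also have "\<dots> = w - tt ^ p"
    by (simp add: w_def T' tt_def const_power_p)
  finally have "rr dvd w - tt ^ p" .
  with that phi_g jac show ?thesis by blast
qed

end

section \<open>Ideals with two generators\<close>

definition in_ideal :: "'a::comm_ring_1 \<Rightarrow> 'a \<Rightarrow> 'a \<Rightarrow> bool" where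
  "in_ideal r t z \<longleftrightarrow> (\<exists>u v. z = r * u + t * v)"

definition in_ideal_sq :: "'a::comm_ring_1 \<Rightarrow> 'a \<Rightarrow> 'a \<Rightarrow> bool" where
  "in_ideal_sq r t z \<longleftrightarrow> (\<exists>u v w. z = r * r * u + r * t * v + t * t * w)"

lemma in_ideal_add: "in_ideal r t x \<Longrightarrow> in_ideal r t y \<Longrightarrow> in_ideal r t (x + y)"
proof -
  assume "in_ideal r t x" "in_ideal r t y"
  then obtain u v u' v' where "x = r * u + t * v" "y = r * u' + t * v'"
    unfolding in_ideal_def by blast
  then have "x + y = r * (u + u') + t * (v + v')" by (simp add: algebra_simps)
  then show ?thesis unfolding in_ideal_def by blast
qed

lemma in_ideal_mult: "in_ideal r t x \<Longrightarrow> in_ideal r t (c * x)"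
proof -
  assume "in_ideal r t x"
  then obtain u v where "x = r * u + t * v" unfolding in_ideal_def by blast
  then have "c * x = r * (c * u) + t * (c * v)" by (simp add: algebra_simps)
  then show ?thesis unfolding in_ideal_def by blast
qed

lemma in_ideal_sq_0: "in_ideal_sq r t 0"
  unfolding in_ideal_sq_def by (intro exI[of _ 0]) simp

lemma in_ideal_sq_add: "in_ideal_sq r t x \<Longrightarrow> in_ideal_sq r t y \<Longrightarrow> in_ideal_sq r t (x + y)"
proof -
  assume "in_ideal_sq r t x" "in_ideal_sq r t y"
  then obtain u v w u' v' w' where "x = r * r * u + r * t * v + t * t * w"
    "y = r * r * u' + r * t * v' + t * t * w'" unfolding in_ideal_sq_def by blast
  then have "x + y = r * r * (u + u') + r * t * (v + v') + t * t * (w + w')"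
    by (simp add: algebra_simps)
  then show ?thesis unfolding in_ideal_sq_def by blast
qed

lemma in_ideal_sq_mult: "in_ideal_sq r t x \<Longrightarrow> in_ideal_sq r t (c * x)"
proof -
  assume "in_ideal_sq r t x"
  then obtain u v w where "x = r * r * u + r * t * v + t * t * w"
    unfolding in_ideal_sq_def by blast
  then have "c * x = r * r * (c * u) + r * t * (c * v) + t * t * (c * w)"
    by (simp add: algebra_simps)
  then show ?thesis unfolding in_ideal_sq_def by blast
qed

lemma in_ideal_sq_sum: "(\<And>i. i \<in> A \<Longrightarrow> in_ideal_sq r t (g i)) \<Longrightarrow> in_ideal_sq r t (sum g A)"
  by (induction A rule: infinite_finite_induct) (auto intro: in_ideal_sq_0 in_ideal_sq_add)

lemma in_ideal_sq_times: "in_ideal r t x \<Longrightarrow> in_ideal r t y \<Longrightarrow> in_ideal_sq r t (x * y)"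
proof -
  assume "in_ideal r t x" "in_ideal r t y"
  then obtain u v u' v' where "x = r * u + t * v" "y = r * u' + t * v'"
    unfolding in_ideal_def by blast
  then have "x * y = r * r * (u * u') + r * t * (u * v' + v * u') + t * t * (v * v')"
    by (simp add: algebra_simps)
  then show ?thesis unfolding in_ideal_sq_def by blast
qed

lemma in_ideal_sq_imp_in_ideal: "in_ideal_sq r t x \<Longrightarrow> in_ideal r t x"
proof -
  assume "in_ideal_sq r t x"
  then obtain u v w where "x = r * r * u + r * t * v + t * t * w"
    unfolding in_ideal_sq_def by blast
  then have "x = r * (r * u + t * v) + t * (t * w)" by (simp add: algebra_simps)
  then show ?thesis unfolding in_ideal_def by blast
qed

text \<open>Nakayama's lemma for the ideal \<open>(r, t)\<close>: the hypotheses form a linear system for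
  \<open>(r, t)\<close> whose determinant is congruent to 1 modulo the ideal.\<close>

lemma ideal_eq_square_imp_unit:
  fixes r t :: "'a::idom"
  assumes "r \<noteq> 0" "in_ideal_sq r t r" "in_ideal_sq r t t"
  shows "in_ideal r t 1"
proof -
  obtain u v w where 1: "r = r * r * u + r * t * v + t * t * w"
    using assms(2) unfolding in_ideal_sq_def by blast
  obtain u' v' w' where 2: "t = r * r * u' + r * t * v' + t * t * w'"
    using assms(3) unfolding in_ideal_sq_def by blast
  define A where "A = r * u + t * v"
  define B where "B = t * w"
  define C where "C = r * u'"
  define E where "E = r * v' + t * w'"
  have "r = r * A + t * B" by (subst 1) (simp add: A_def B_def algebra_simps)
  then have r: "r * (1 - A) = t * B" by (simp add: right_diff_distrib diff_eq_eq add.commute)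
  have "t = t * E + r * C" by (subst 2) (simp add: C_def E_def algebra_simps)
  then have t: "t * (1 - E) = r * C" by (simp add: right_diff_distrib diff_eq_eq add.commute)
  \<comment> \<open>Eliminating \<open>t\<close> and cancelling \<open>r\<close> makes the
    determinant of the system vanish.\<close>
  have "r * ((1 - A) * (1 - E)) = B * (t * (1 - E))"
    unfolding mult.assoc[symmetric] r by (simp only: ac_simps)
  also have "\<dots> = r * (B * C)" unfolding t by (simp only: ac_simps)
  finally have "(1 - A) * (1 - E) = B * C" using assms(1) by simp
  then have "1 = A + E - A * E + B * C" by (simp add: algebra_simps)
  also have "\<dots> = r * (u + v' - u * E + u' * B) + t * (v + w' - v * E)"
    by (simp add: A_def E_def B_def C_def algebra_simps)
  finally show ?thesis unfolding in_ideal_def by blast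
qed

text \<open>\<open>W\<close> does not depend on \<open>z\<close>, so that one polynomial serves all
  points of an orbit.\<close>

lemma taylor1_poly:
  fixes t :: "'a::idom poly"
  obtains W where "\<And>z. poly t (x + r * z) = poly t x + r * z * poly W z"
proof -
  have "\<exists>W. \<forall>z. poly t (x + r * z) = poly t x + r * z * poly W z"
  proof (induction t)
    case (pCons c t)
    then obtain W where W: "poly t (x + r * z) = poly t x + r * z * poly W z" for z by blast
    show ?case
      by (intro exI[of _ "[:poly t x:] + [:x, r:] * W"] allI)
        (simp only: poly_pCons W poly_add poly_mult, simp add: algebra_simps)
  qed (auto intro: exI[of _ 0])
  then show ?thesis using that by blast
qed

lemma taylor2_poly:
  fixes t :: "'a::idom poly"
  obtains W where "\<And>z. poly t (x + r * z) = poly t x + r * z * poly (pderiv t) x + (r * z)\<^sup>2 * poly W z"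
proof -
  have "\<exists>W. \<forall>z. poly t (x + r * z) = poly t x + r * z * poly (pderiv t) x + (r * z)\<^sup>2 * poly W z"
  proof (induction t)
    case (pCons c t)
    then obtain W where W: "poly t (x + r * z) =
        poly t x + r * z * poly (pderiv t) x + (r * z)\<^sup>2 * poly W z" for z by blast
    show ?case
      by (intro exI[of _ "[:poly (pderiv t) x:] + [:x, r:] * W"] allI)
        (simp only: poly_pCons W poly_add poly_mult pderiv_pCons,
          simp add: algebra_simps power2_eq_square)
  qed (auto intro: exI[of _ 0])
  then show ?thesis using that by blast
qed

context nagata
begin

section \<open>Gradients of invariants\<close>

lemma morphism_phi_iter: "morphism (\<phi> ^^ i)"
proof (induction i)
  case 0
  show ?case by unfold_locales simp_all
next
  case (Suc i)
  then show ?case using morphism_comp[OF Suc morphism_phi] by (simp add: o_def)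
qed

lemma phi_iter_fixed: "\<phi> u = u \<Longrightarrow> (\<phi> ^^ i) u = u"
  by (induction i) simp_all

lemma phi_iter_Yv: "(\<phi> ^^ i) Yv = Yv + rr * (s * of_nat i)"
proof (induction i)
  case (Suc i)
  have "\<phi> s = s" by (simp add: s_def phi.mult phi_cR phi_F)
  moreover have "cR a * F = rr * s" by (simp add: cR_a s_def)
  ultimately show ?case
    using Suc by (simp add: phi.add phi.mult phi.of_nat phi_Yv rr_def phi_cR phi.one algebra_simps)
qed simp

text \<open>The orbit of \<open>x\<close> is \<open>x + Z (s i)\<close> for a polynomial \<open>Z\<close>, and modulo \<open>r\<close> only the linear
  term of \<open>Z\<close> survives; \<open>i ^ p = i\<close> takes care of the part of \<open>th\<close> in \<open>y ^ p\<close>.\<close>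

lemma orbit_polynomial:
  obtains Om where "\<And>i. (\<phi> ^^ i) Xv = Xv + poly (- pCons 0 ([:tt:] + smult rr Om)) (s * of_nat i)"
proof -
  interpret m: morphism "map_poly cR" by (rule morphism.map_poly_morphism[OF morphism_cR])
  obtain W1 where "\<And>z. poly (map_poly cR th1) (Yv ^ p + e * rr * z) =
      poly (map_poly cR th1) (Yv ^ p) + e * rr * z * poly W1 z"
    using taylor1_poly by blast
  then have W1: "evalY th1 (Yv ^ p + e * rr * z) = evalY th1 (Yv ^ p) + e * rr * z * poly W1 z" for z
    by (simp add: evalY_def)
  obtain W2 where "\<And>z. poly (map_poly cR th2) (Yv + rr * z) = poly (map_poly cR th2) Yv
      + rr * z * poly (pderiv (map_poly cR th2)) Yv + (rr * z)\<^sup>2 * poly W2 z"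
    using taylor2_poly by blast
  then have W2: "evalY th2 (Yv + rr * z) = evalY th2 Yv + rr * z * tt + (rr * z)\<^sup>2 * poly W2 z" for z
    using evalY_Yv[of "pderiv th2"]
    by (simp add: evalY_def morphism.pderiv[OF morphism_cR] tt_def)
  define e' where "e' = (cR a * F) ^ (p - 2) * F"
  have e': "e = cR d * rr * e'"
    unfolding e_def e'_def p_Suc(2) by (simp add: cR_a)
  define Om where "Om = smult e' W1 + pCons 0 W2"
  have "(\<phi> ^^ i) Xv = Xv + poly (- pCons 0 ([:tt:] + smult rr Om)) (s * of_nat i)" for i
  proof -
    interpret i: morphism "\<phi> ^^ i" by (rule morphism_phi_iter)
    have icR: "(\<phi> ^^ i) (cR c) = cR c" for c by (rule phi_iter_fixed[OF phi_cR])
    define z where "z = s * of_nat i"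
    have Y: "(\<phi> ^^ i) Yv = Yv + rr * z" by (simp add: phi_iter_Yv z_def)
    have "(of_nat i :: 'a poly poly) ^ p = of_nat i"
      using fermat_CHAR[where 'a = "'a poly poly", of i] p by simp
    then have "(rr * z) ^ p = e * rr * z"
      using e_mult by (simp add: z_def power_mult_distrib cR_a s_def ac_simps)
    then have Yp: "(Yv + rr * z) ^ p = Yv ^ p + e * rr * z"
      by (simp add: freshman)
    \<comment> \<open>As \<open>f\<close> is fixed, the orbit of \<open>y\<close> determines that of
      \<open>x\<close>, once \<open>a\<close> is cancelled.\<close>
    have "cR a * (\<phi> ^^ i) Xv + evalY th (Yv + rr * z) = cR a * Xv + evalY th Yv"
      using phi_iter_fixed[OF phi_f, of i]
      by (simp only: f_def i.add i.mult icR evalY_morphism[OF morphism_phi_iter icR] Y)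
    then have "cR a * (\<phi> ^^ i) Xv = cR a * Xv - (e * rr * z * poly W1 z
        + cR d * (rr * z * tt + (rr * z)\<^sup>2 * poly W2 z))"
      unfolding evalY_th[of "Yv + rr * z"] evalY_th[of Yv] Yp W1 W2 by (simp add: algebra_simps)
    also have "\<dots> = cR a * (Xv + poly (- pCons 0 ([:tt:] + smult rr Om)) z)"
      by (simp add: Om_def e' cR_a power2_eq_square algebra_simps)
    finally show ?thesis using a_nz by (simp add: z_def)
  qed
  then show ?thesis using that by blast
qed

text \<open>\<open>H\<close> is \<open>u\<close> evaluated at \<open>x + Z(T)\<close> and
  \<open>y + r T\<close>. Taylor terms of second and higher order are products of at least two
  elements of (r, t), so modulo the square only the first-order terms are left.\<close>

lemma expansion_along_orbit:
  assumes Z: "\<And>i. (\<phi> ^^ i) Xv = Xv + poly Z (s * of_nat i)" and Z0: "coeff Z 0 = 0"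
    and Z_ideal: "\<And>m. in_ideal rr tt (coeff Z m)"
  shows "\<exists>H. (\<forall>i. poly H (s * of_nat i) = (\<phi> ^^ i) u) \<and> coeff H 0 = u \<and>
    coeff H 1 = coeff Z 1 * dx u + rr * dy u \<and>
    (\<forall>m\<ge>2. in_ideal_sq rr tt (coeff H m - coeff Z m * dx u))"
proof (induction u rule: poly2_generated)
  case (1 c)
  show ?case
    using phi_iter_fixed[OF phi_cR, of _ c]
    by (intro exI[of _ "[:cR c:]"]) (auto simp: coeff_pCons in_ideal_sq_0 split: nat.splits)
next
  case 2
  show ?case
    using Z Z0 by (intro exI[of _ "[:Xv:] + Z"])
      (auto simp: coeff_pCons in_ideal_sq_0 split: nat.splits)
next
  case 3
  show ?case
    by (intro exI[of _ "[:Yv, rr:]"])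
      (auto simp: phi_iter_Yv coeff_pCons in_ideal_sq_0 algebra_simps split: nat.splits)
next
  case (4 u v)
  then obtain H G where
    "\<forall>i. poly H (s * of_nat i) = (\<phi> ^^ i) u" "coeff H 0 = u" "coeff H 1 = coeff Z 1 * dx u + rr * dy u"
    "\<forall>m\<ge>2. in_ideal_sq rr tt (coeff H m - coeff Z m * dx u)"
    "\<forall>i. poly G (s * of_nat i) = (\<phi> ^^ i) v" "coeff G 0 = v" "coeff G 1 = coeff Z 1 * dx v + rr * dy v"
    "\<forall>m\<ge>2. in_ideal_sq rr tt (coeff G m - coeff Z m * dx v)" by (elim exE conjE) (rule that)
  moreover from this have "in_ideal_sq rr tt (coeff (H + G) m - coeff Z m * dx (u + v))" if "m \<ge> 2" for m
    using in_ideal_sq_add[of rr tt "coeff H m - coeff Z m * dx u" "coeff G m - coeff Z m * dx v"] that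
    by (simp add: derivation.add[OF derivation_dx] algebra_simps)
  ultimately show ?case
    by (intro exI[of _ "H + G"]) (simp add: morphism.add[OF morphism_phi_iter]
        derivation.add[OF derivation_dx] derivation.add[OF derivation_dy] algebra_simps)
next
  case (5 u v)
  then obtain H G where H:
    "\<forall>i. poly H (s * of_nat i) = (\<phi> ^^ i) u" "coeff H 0 = u" "coeff H 1 = coeff Z 1 * dx u + rr * dy u"
    "\<forall>m\<ge>2. in_ideal_sq rr tt (coeff H m - coeff Z m * dx u)" and G:
    "\<forall>i. poly G (s * of_nat i) = (\<phi> ^^ i) v" "coeff G 0 = v" "coeff G 1 = coeff Z 1 * dx v + rr * dy v"
    "\<forall>m\<ge>2. in_ideal_sq rr tt (coeff G m - coeff Z m * dx v)" by (elim exE conjE) (rule that)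
  have in_ideal: "in_ideal rr tt (coeff K m)" if K: "coeff K 1 = coeff Z 1 * dx w + rr * dy w"
    "\<forall>m\<ge>2. in_ideal_sq rr tt (coeff K m - coeff Z m * dx w)" "m \<ge> 1" for K w m
  proof -
    have Zw: "in_ideal rr tt (coeff Z m * dx w)" for m
      using in_ideal_mult[OF Z_ideal] by (simp add: mult.commute)
    show ?thesis
    proof (cases "m = 1")
      case True
      have "in_ideal rr tt (rr * dy w)"
        unfolding in_ideal_def by (intro exI[of _ "dy w"] exI[of _ 0]) simp
      then show ?thesis using in_ideal_add[OF Zw[of 1]] K(1) True by simp
    next
      case False
      then have "in_ideal rr tt (coeff K m - coeff Z m * dx w)"
        using K by (intro in_ideal_sq_imp_in_ideal) simp
      from in_ideal_add[OF this Zw[of m]] show ?thesis by simp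
    qed
  qed
  have "in_ideal_sq rr tt (coeff (H * G) m - coeff Z m * dx (u * v))" if m: "m \<ge> 2" for m
  proof -
    obtain n where n: "m = Suc n" using m by (cases m) auto
    \<comment> \<open>The end terms i = 0 and i = m give the Leibniz rule; each middle term
      multiplies two coefficients from (r, t).\<close>
    have "coeff (H * G) m = (\<Sum>i\<le>Suc n. coeff H i * coeff G (Suc n - i))"
      by (simp add: coeff_mult n)
    also have "\<dots> = (\<Sum>i\<le>n. coeff H i * coeff G (Suc n - i)) + coeff H (Suc n) * v"
      by (simp add: G)
    also have "{..n} = insert 0 {1..n}" by auto
    also have "(\<Sum>i\<in>insert 0 {1..n}. coeff H i * coeff G (Suc n - i)) =
        u * coeff G (Suc n) + (\<Sum>i=1..n. coeff H i * coeff G (Suc n - i))"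
      by (simp add: H)
    finally have "coeff (H * G) m - coeff Z m * dx (u * v) =
        u * (coeff G m - coeff Z m * dx v) + v * (coeff H m - coeff Z m * dx u)
        + (\<Sum>i=1..n. coeff H i * coeff G (Suc n - i))"
      by (simp add: n derivation.mult[OF derivation_dx] algebra_simps)
    moreover have "in_ideal_sq rr tt (\<Sum>i=1..n. coeff H i * coeff G (Suc n - i))"
      using in_ideal[OF H(3,4)] in_ideal[OF G(3,4)]
      by (intro in_ideal_sq_sum in_ideal_sq_times) auto
    ultimately show ?thesis
      using H(4) G(4) m by (simp add: in_ideal_sq_add in_ideal_sq_mult)
  qed
  moreover have "coeff (H * G) 1 = coeff Z 1 * dx (u * v) + rr * dy (u * v)"
    using H G by (simp add: coeff_mult derivation.mult[OF derivation_dx]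
        derivation.mult[OF derivation_dy] algebra_simps)
  ultimately show ?case
    using H G by (intro exI[of _ "H * G"])
      (simp add: morphism.mult[OF morphism_phi_iter] coeff_mult_0)
qed

text \<open>\<open>H(s T) - u\<close> vanishes on the prime field, so the coefficient of
  \<open>T\<close> in its reduction is zero. This expresses \<open>s H_1\<close> through the
  \<open>s ^ m H_m\<close> with \<open>m \<ge> p\<close>, and \<open>H_m\<close> is
  \<open>Z_m u_x\<close> up to the square of (r, t).\<close>

lemma gradient_of_invariant:
  obtains \<eta> where "rr dvd \<eta> + tt"
    "\<And>u. \<phi> u = u \<Longrightarrow> \<exists>z. in_ideal_sq rr tt z \<and> \<eta> * dx u + rr * dy u = s ^ (p - 1) * z"
proof -
  obtain Om where Om: "\<And>i. (\<phi> ^^ i) Xv = Xv + poly (- pCons 0 ([:tt:] + smult rr Om)) (s * of_nat i)"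
    using orbit_polynomial by blast
  define Z where "Z = - pCons 0 ([:tt:] + smult rr Om)"
  have Zm: "coeff Z m = - rr * coeff Om (m - 1)" if "m \<ge> 2" for m
    using that by (auto simp: Z_def coeff_pCons split: nat.splits)
  have Z1: "coeff Z 1 = - tt - rr * coeff Om 0"
    by (simp add: Z_def)
  have Z0: "coeff Z 0 = 0"
    by (simp add: Z_def)
  have "in_ideal rr tt (coeff Z m)" for m
  proof -
    consider "m = 0" | "m = 1" | "m \<ge> 2" by linarith
    then show ?thesis
    proof cases
      case 1
      then show ?thesis using Z0 unfolding in_ideal_def by (intro exI[of _ 0]) simp
    next
      case 2
      then show ?thesis using Z1 unfolding in_ideal_def
        by (intro exI[of _ "- coeff Om 0"] exI[of _ "-1"]) simp
    next
      case 3
      then show ?thesis using Zm unfolding in_ideal_def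
        by (intro exI[of _ "- coeff Om (m - 1)"] exI[of _ 0]) simp
    qed
  qed
  note expansion = expansion_along_orbit[OF Om[folded Z_def] Z0 this]
  \<comment> \<open>The exponents from 2 on that reduce to 1; all are at least p, which is where the
    factor \<open>s ^ p\<close> comes from.\<close>
  define M where "M N = {m \<in> {2..N}. (p - 1) dvd (m - 1)}" for N
  have M_fin: "finite (M N)" for N by (simp add: M_def)
  have M_p: "m \<ge> p" if "m \<in> M N" for m N
  proof -
    have "m - 1 > 0" "(p - 1) dvd (m - 1)" using that by (auto simp: M_def)
    then have "p - 1 \<le> m - 1" by (intro dvd_imp_le)
    then show ?thesis using \<open>m - 1 > 0\<close> by linarith
  qed
  \<comment> \<open>The coefficient of \<open>T\<close> in the reduction of \<open>Z(s T)\<close>,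
    divided by \<open>s\<close>. It absorbs all terms \<open>Z_m u_x\<close> and does not depend on
    \<open>u\<close>.\<close>
  define \<eta> where "\<eta> = coeff Z 1 + (\<Sum>m\<in>M (degree Z). s ^ (m - 1) * coeff Z m)"
  have \<eta>: "\<eta> = coeff Z 1 + (\<Sum>m\<in>M N. s ^ (m - 1) * coeff Z m)" if "degree Z \<le> N" for N
    unfolding \<eta>_def using that
    by (intro arg_cong[of _ _ "(+) (coeff Z 1)"] sum.mono_neutral_left M_fin)
      (auto simp: M_def intro: le_degree)
  have "rr dvd (\<Sum>m\<in>M (degree Z). s ^ (m - 1) * coeff Z m)"
    by (intro dvd_sum) (auto simp: M_def Zm)
  moreover have "\<eta> + tt = (\<Sum>m\<in>M (degree Z). s ^ (m - 1) * coeff Z m) - rr * coeff Om 0"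
    unfolding \<eta>_def Z1 by simp
  ultimately have 1: "rr dvd \<eta> + tt" by simp
  have 2: "\<exists>z. in_ideal_sq rr tt z \<and> \<eta> * dx u + rr * dy u = s ^ (p - 1) * z" if u: "\<phi> u = u" for u
  proof -
    obtain H where H: "\<And>i. poly H (s * of_nat i) = (\<phi> ^^ i) u" "coeff H 0 = u"
      "coeff H 1 = coeff Z 1 * dx u + rr * dy u"
      "\<And>m. m \<ge> 2 \<Longrightarrow> in_ideal_sq rr tt (coeff H m - coeff Z m * dx u)"
      using expansion[of u] by blast
    define G where "G = pcompose (H - [:u:]) (monom s 1)"
    define N where "N = max 1 (max (degree G) (degree Z))"
    have G: "coeff G m = s ^ m * coeff H m" if "m \<ge> 1" for m
      using that by (simp add: G_def coeff_pCons split: nat.splits)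
    have "poly G (of_nat i) = 0" for i
      using H(1)[of i] phi_iter_fixed[OF u, of i]
      by (simp add: G_def poly_pcompose poly_monom)
    then have "(\<Sum>m | m \<in> {1..N} \<and> (p - 1) dvd (m - 1). coeff G m) = 0"
      using vanishing_on_prime_field[of G N] p by (simp add: N_def)
    also have "{m. m \<in> {1..N} \<and> (p - 1) dvd (m - 1)} = insert 1 (M N)"
      by (auto simp: M_def N_def)
    also have "(\<Sum>m\<in>insert 1 (M N). coeff G m) = s * coeff H 1 + (\<Sum>m\<in>M N. s ^ m * coeff H m)"
    proof -
      have "1 \<notin> M N" by (simp add: M_def)
      moreover have "(\<Sum>m\<in>M N. coeff G m) = (\<Sum>m\<in>M N. s ^ m * coeff H m)"
        by (intro sum.cong G) (auto simp: M_def)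
      ultimately show ?thesis using M_fin[of N] G[of 1] by simp
    qed
    finally have 0: "s * coeff H 1 + (\<Sum>m\<in>M N. s ^ m * coeff H m) = 0" .
    define z where "z = (\<Sum>m\<in>M N. s ^ (m - p) * (coeff H m - coeff Z m * dx u))"
    have "s * \<eta> = s * coeff Z 1 + (\<Sum>m\<in>M N. s ^ m * coeff Z m)"
    proof -
      have "s * \<eta> = s * coeff Z 1 + (\<Sum>m\<in>M N. s * (s ^ (m - 1) * coeff Z m))"
        using \<eta>[of N] by (simp add: N_def distrib_left sum_distrib_left)
      also have "(\<Sum>m\<in>M N. s * (s ^ (m - 1) * coeff Z m)) = (\<Sum>m\<in>M N. s ^ m * coeff Z m)"
      proof (intro sum.cong refl)
        fix m assume "m \<in> M N"
        then obtain k where "m = Suc k" by (cases m) (auto simp: M_def)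
        then show "s * (s ^ (m - 1) * coeff Z m) = s ^ m * coeff Z m" by simp
      qed
      finally show ?thesis .
    qed
    then have "(s * \<eta>) * dx u = s * coeff Z 1 * dx u + (\<Sum>m\<in>M N. s ^ m * coeff Z m * dx u)"
      by (simp only: distrib_right sum_distrib_right)
    then have "s * (\<eta> * dx u + rr * dy u) = s * coeff H 1 + (\<Sum>m\<in>M N. s ^ m * coeff Z m * dx u)"
      unfolding H(3) by (simp only: distrib_left mult.assoc[symmetric] add.assoc add.commute add.left_commute)
    also have "\<dots> = - (\<Sum>m\<in>M N. s ^ m * (coeff H m - coeff Z m * dx u))"
      using 0 by (simp add: sum_subtractf algebra_simps eq_neg_iff_add_eq_0)
    also have "(\<Sum>m\<in>M N. s ^ m * (coeff H m - coeff Z m * dx u)) = s ^ p * z"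
      unfolding z_def sum_distrib_left
    proof (intro sum.cong refl)
      fix m assume "m \<in> M N"
      then have "s ^ m = s ^ p * s ^ (m - p)"
        using M_p by (simp flip: power_add)
      then show "s ^ m * (coeff H m - coeff Z m * dx u) =
          s ^ p * (s ^ (m - p) * (coeff H m - coeff Z m * dx u))" by (simp add: mult.assoc)
    qed
    also have "- (s ^ p * z) = s * (s ^ (p - 1) * (- 1 * z))"
      using p2 by (simp flip: mult.assoc power_Suc)
    finally have "\<eta> * dx u + rr * dy u = s ^ (p - 1) * (- 1 * z)"
      using s_nz by (simp only: mult_cancel_left) simp
    moreover have "in_ideal_sq rr tt z"
      unfolding z_def by (intro in_ideal_sq_sum in_ideal_sq_mult H(4)) (auto simp: M_def)
    ultimately show ?thesis using in_ideal_sq_mult by blast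
  qed
  show ?thesis using that[OF 1 2] .
qed

end

section \<open>Determinants\<close>

text \<open>Cramer's rule over a commutative ring: expand linearly in column \<open>k\<close>; for
  \<open>l \<noteq> k\<close> two columns coincide. The transpose turns columns into rows.\<close>

lemma det_replace_column:
  fixes M :: "'b::comm_ring_1^'n^'n"
  shows "det (\<chi> i j. if j = k then \<Sum>l\<in>UNIV. M $ i $ l * v l else M $ i $ j) = v k * det M"
proof -
  define N where "N = transpose M"
  have "det (\<chi> i j. if j = k then \<Sum>l\<in>UNIV. M $ i $ l * v l else M $ i $ j) =
      det (transpose (\<chi> i j. if j = k then \<Sum>l\<in>UNIV. M $ i $ l * v l else M $ i $ j))"
    by simp
  also have "transpose (\<chi> i j. if j = k then \<Sum>l\<in>UNIV. M $ i $ l * v l else M $ i $ j) =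
      (\<chi> i. if i = k then (\<Sum>l\<in>UNIV. v l *s N $ l) else N $ i)"
    by (simp add: vec_eq_iff transpose_def N_def mult.commute)
  also have "det \<dots> = (\<Sum>l\<in>UNIV. det (\<chi> i. if i = k then v l *s N $ l else N $ i))"
    by (rule det_linear_row_sum) simp
  also have "\<dots> = (\<Sum>l\<in>UNIV. if l = k then v k * det M else 0)"
  proof (intro sum.cong refl)
    fix l
    have "det (\<chi> i. if i = k then v l *s N $ l else N $ i) =
        v l * det (\<chi> i. if i = k then N $ l else N $ i)"
      by (rule det_row_mul)
    also have "\<dots> = (if l = k then v k * det M else 0)"
    proof (cases "l = k")
      case True
      then have "(\<chi> i. if i = k then N $ l else N $ i) = N" by (simp add: vec_eq_iff)
      then show ?thesis using True by (simp add: N_def)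
    next
      case False
      have "det (\<chi> i. if i = k then N $ l else N $ i) = 0"
        by (rule det_identical_rows[OF False]) (use False in \<open>simp add: row_def vec_eq_iff\<close>)
      then show ?thesis using False by simp
    qed
    finally show "det (\<chi> i. if i = k then v l *s N $ l else N $ i) = (if l = k then v k * det M else 0)" .
  qed
  finally show ?thesis by simp
qed

text \<open>Each term of the permutation expansion contains exactly one entry of column
  \<open>k\<close>, in row \<open>inv \<pi> k\<close>; \<open>x \<pi>\<close> is that term without
  \<open>c\<close>.\<close>

lemma det_column_in_ideal_sq:
  fixes M :: "'b::comm_ring_1^'n^'n"
  assumes "\<And>i. in_ideal_sq r t (z i)" "\<And>i. M $ i $ k = c * z i"
  shows "\<exists>x. in_ideal_sq r t x \<and> det M = c * x"
proof -
  define x where "x \<pi> = of_int (sign \<pi>) * (\<Prod>i\<in>UNIV - {inv \<pi> k}. M $ i $ \<pi> i) * z (inv \<pi> k)"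
    for \<pi> :: "'n \<Rightarrow> 'n"
  have "det M = (\<Sum>\<pi> | \<pi> permutes UNIV. c * x \<pi>)"
    unfolding det_def
  proof (intro sum.cong refl)
    fix \<pi> :: "'n \<Rightarrow> 'n" assume "\<pi> \<in> {\<pi>. \<pi> permutes UNIV}"
    then have "\<pi> (inv \<pi> k) = k" by (simp add: permutes_inverses)
    moreover have "(\<Prod>i\<in>UNIV. M $ i $ \<pi> i) =
        M $ inv \<pi> k $ \<pi> (inv \<pi> k) * (\<Prod>i\<in>UNIV - {inv \<pi> k}. M $ i $ \<pi> i)"
      by (rule prod.remove) simp_all
    ultimately show "of_int (sign \<pi>) * (\<Prod>i\<in>UNIV. M $ i $ \<pi> i) = c * x \<pi>"
      by (simp add: x_def assms(2) ac_simps)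
  qed
  also have "\<dots> = c * (\<Sum>\<pi> | \<pi> permutes UNIV. x \<pi>)"
    by (simp add: sum_distrib_left)
  finally have "det M = c * (\<Sum>\<pi> | \<pi> permutes UNIV. x \<pi>)" .
  moreover have "in_ideal_sq r t (\<Sum>\<pi> | \<pi> permutes UNIV. x \<pi>)"
    unfolding x_def by (intro in_ideal_sq_sum in_ideal_sq_mult assms(1))
  ultimately show ?thesis by blast
qed

text \<open>A permutation contributes only if it fixes every index besides \<open>x\<close> and
  \<open>y\<close>, which leaves the identity and the transposition.\<close>

lemma det_two_nontrivial_rows:
  fixes M :: "'b::comm_ring_1^'n^'n"
  assumes "x \<noteq> y" and M: "\<And>i j. i \<noteq> x \<Longrightarrow> i \<noteq> y \<Longrightarrow> M $ i $ j = (if j = i then 1 else 0)"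
  shows "det M = M $ x $ x * M $ y $ y - M $ x $ y * M $ y $ x"
proof -
  define g where "g \<pi> = of_int (sign \<pi>) * (\<Prod>i\<in>UNIV. M $ i $ \<pi> i)" for \<pi> :: "'n \<Rightarrow> 'n"
  let ?\<tau> = "Transposition.transpose x y"
  have "g \<pi> = 0" if \<pi>: "\<pi> permutes UNIV" "\<pi> \<notin> {id, ?\<tau>}" for \<pi>
  proof -
    have "\<exists>i. i \<noteq> x \<and> i \<noteq> y \<and> \<pi> i \<noteq> i"
    proof (rule ccontr)
      assume "\<not> ?thesis"
      then have "\<pi> permutes {x, y}"
        using \<pi>(1) by (intro permutes_superset[OF \<pi>(1)]) auto
      then show False using \<pi>(2) by (simp add: permutes_doubleton_iff)
    qed
    then obtain i where "i \<noteq> x" "i \<noteq> y" "\<pi> i \<noteq> i" by blast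
    then have "M $ i $ \<pi> i = 0" by (simp add: M)
    then have "(\<Prod>i\<in>UNIV. M $ i $ \<pi> i) = 0"
      by (intro prod_zero) auto
    then show ?thesis by (simp add: g_def)
  qed
  moreover have "?\<tau> permutes UNIV" "id permutes (UNIV :: 'n set)"
    by (simp_all add: permutes_swap_id permutes_id)
  ultimately have "det M = (\<Sum>\<pi>\<in>{id, ?\<tau>}. g \<pi>)"
    unfolding det_def g_def[symmetric] by (intro sum.mono_neutral_right) auto
  moreover have "id \<noteq> ?\<tau>"
    using \<open>x \<noteq> y\<close> by (metis id_apply transpose_apply_first)
  moreover have "g \<pi> = of_int (sign \<pi>) * (M $ x $ \<pi> x * M $ y $ \<pi> y)"
    if "\<And>i. i \<noteq> x \<Longrightarrow> i \<noteq> y \<Longrightarrow> \<pi> i = i" for \<pi>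
  proof -
    have "(\<Prod>i\<in>UNIV. M $ i $ \<pi> i) = (\<Prod>i\<in>{x, y}. M $ i $ \<pi> i)"
      using that M by (intro prod.mono_neutral_right) auto
    then show ?thesis using \<open>x \<noteq> y\<close> by (simp add: g_def)
  qed
  ultimately show ?thesis
    using \<open>x \<noteq> y\<close> by (simp add: sign_swap_id sign_id)
qed

section \<open>Comparison of Jacobians\<close>

context nagata
begin

text \<open>\<open>del\<close> lists the partial derivatives and \<open>P\<close> the supposed
  generators; \<open>V\<close> holds the variables of the ground ring, which are themselves
  invariant. This form covers isomorphisms over R and over k at once.\<close>

lemma ideal_is_unit_ideal:
  fixes del :: "'n::finite \<Rightarrow> 'a poly poly \<Rightarrow> 'a poly poly" and P V :: "'n \<Rightarrow> 'a poly poly"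
  assumes xy: "jx \<noteq> jy" "del jx = dx" "del jy = dy"
    and P: "\<And>i. \<phi> (P i) = P i"
    and V: "\<And>k. k \<noteq> jx \<Longrightarrow> k \<noteq> jy \<Longrightarrow> \<phi> (V k) = V k"
      "\<And>j k. k \<noteq> jx \<Longrightarrow> k \<noteq> jy \<Longrightarrow> del j (V k) = (if j = k then 1 else 0)"
    and chain: "\<And>u. \<phi> u = u \<Longrightarrow> \<exists>c. \<forall>j. del j u = (\<Sum>i\<in>UNIV. c i * del j (P i))"
    and coprime: "\<And>w. rr dvd w - tt ^ p \<Longrightarrow> no_common_factor rr w"
  shows "in_ideal rr tt 1"
proof -
  define M :: "'a poly poly ^ 'n ^ 'n" where "M = (\<chi> i j. del j (P i))"
  have det_dvd: "det M dvd jac f' v" if v: "\<phi> v = v" for v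
  proof -
    \<comment> \<open>Filling up with the variables \<open>V\<close> makes all other rows trivial,
      so that the full Jacobian determinant of \<open>U\<close> reduces to J(f', v).\<close>
    define U where "U = (\<lambda>k. if k = jx then f' else if k = jy then v else V k)"
    have "\<phi> (U k) = U k" for k
      by (simp add: U_def phi_f' v V)
    then have "\<forall>k. \<exists>c. \<forall>j. del j (U k) = (\<Sum>i\<in>UNIV. c i * del j (P i))"
      by (intro allI chain)
    from choice[OF this] obtain c where c: "\<forall>k j. del j (U k) = (\<Sum>i\<in>UNIV. c k i * del j (P i))"
      by (rule exE)
    have "(\<chi> k j. del j (U k)) = (\<chi> k i. c k i) ** M"
      by (simp add: vec_eq_iff matrix_matrix_mult_def M_def c)
    then have "det M dvd det (\<chi> k j. del j (U k))"
      by (simp add: det_mul)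
    also have "det (\<chi> k j. del j (U k)) = jac f' v"
      by (subst det_two_nontrivial_rows[OF xy(1)])
        (use xy V in \<open>auto simp: U_def jac_def\<close>)
    finally show ?thesis .
  qed
  obtain g w where g: "\<phi> g = g" "jac f' g = s ^ (p - 1) * w" "rr dvd w - tt ^ p"
    by (rule second_invariant)
  obtain k1 where k1: "- (rr ^ p * s ^ (p - 1)) = det M * k1"
    using det_dvd[OF phi_q] unfolding jac_f'_q \<kappa>_def by (rule dvdE)
  obtain k2 where k2: "s ^ (p - 1) * w = det M * k2"
    using det_dvd[OF g(1)] unfolding g(2) by (rule dvdE)
  have "- (rr ^ p * s ^ (p - 1)) \<noteq> 0" using rr_nz s_nz by simp
  then have det_nz: "det M \<noteq> 0" using k1 by (metis mult_zero_left)
  have "det M * (k1 * w) = - (rr ^ p * (s ^ (p - 1) * w))"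
    using k1 by (metis mult.assoc mult_minus_left)
  also have "\<dots> = det M * (rr ^ p * - k2)"
    unfolding k2 by (simp add: ac_simps)
  finally have "k1 * w = rr ^ p * - k2" using det_nz by (metis mult_left_cancel)
  then have "rr ^ p dvd k1 * w" by (rule dvdI)
  then have "rr ^ p dvd k1"
    by (rule no_common_factorD[OF no_common_factor_power[OF coprime[OF g(3)]]])
  then obtain k3 where "k1 = rr ^ p * k3" by (rule dvdE)
  then have "rr ^ p * (det M * k3) = rr ^ p * (- (s ^ (p - 1)))"
    using k1 by (simp add: ac_simps)
  then have k3: "det M * k3 = - (s ^ (p - 1))" using rr_nz by (metis mult_left_cancel power_not_zero)
  obtain \<eta> where \<eta>: "rr dvd \<eta> + tt"
    "\<And>u. \<phi> u = u \<Longrightarrow> \<exists>z. in_ideal_sq rr tt z \<and> \<eta> * dx u + rr * dy u = s ^ (p - 1) * z"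
    using gradient_of_invariant by blast
  have "\<forall>i. \<exists>z. in_ideal_sq rr tt z \<and> \<eta> * dx (P i) + rr * dy (P i) = s ^ (p - 1) * z"
    using \<eta>(2)[OF P] by (rule allI)
  from choice[OF this] obtain z where z: "\<And>i. in_ideal_sq rr tt (z i)"
    "\<And>i. \<eta> * dx (P i) + rr * dy (P i) = s ^ (p - 1) * z i"
    by blast
  \<comment> \<open>The coordinates of the vector field whose values on invariants are bounded;
    Cramer's rule recovers them, up to \<open>det M\<close>, from its values on the
    \<open>P i\<close>.\<close>
  define v where "v = (\<lambda>j. if j = jx then \<eta> else if j = jy then rr else 0)"
  have v: "(\<Sum>l\<in>UNIV. M $ i $ l * v l) = s ^ (p - 1) * z i" for i
  proof -
    have "(\<Sum>l\<in>UNIV. M $ i $ l * v l) = (\<Sum>l\<in>{jx, jy}. M $ i $ l * v l)"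
      by (intro sum.mono_neutral_right) (auto simp: v_def)
    also have "\<dots> = \<eta> * dx (P i) + rr * dy (P i)"
      using xy by (simp add: v_def M_def mult.commute)
    finally show ?thesis using z(2) by simp
  qed
  have v_in: "in_ideal_sq rr tt (v k)" for k
  proof -
    have "\<exists>x. in_ideal_sq rr tt x \<and>
        det (\<chi> i j. if j = k then \<Sum>l\<in>UNIV. M $ i $ l * v l else M $ i $ j) = s ^ (p - 1) * x"
      by (rule det_column_in_ideal_sq[where z = z and k = k]) (simp_all add: z(1) v)
    then obtain x where x: "in_ideal_sq rr tt x" "v k * det M = s ^ (p - 1) * x"
      unfolding det_replace_column by blast
    have "s ^ (p - 1) * (- 1 * v k) = v k * (det M * k3)"
      unfolding k3 by simp
    also have "\<dots> = s ^ (p - 1) * (k3 * x)"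
      using x(2) by (metis mult.assoc mult.commute)
    finally have "- 1 * v k = k3 * x"
      using s_nz by (metis mult_left_cancel power_not_zero)
    then have "v k = - k3 * x" by (metis minus_minus mult_1_left mult_minus_left)
    then show ?thesis using in_ideal_sq_mult[OF x(1), of "- k3"] by (simp only:)
  qed
  have rr_in: "in_ideal_sq rr tt rr" and \<eta>_in: "in_ideal_sq rr tt \<eta>"
    using v_in[of jy] v_in[of jx] xy(1) by (simp_all add: v_def)
  obtain m where "\<eta> + tt = rr * m" using \<eta>(1) by (rule dvdE)
  then have "tt = m * rr + (-1) * \<eta>" by (simp add: algebra_simps eq_diff_eq)
  then have "in_ideal_sq rr tt tt"
    using in_ideal_sq_add[OF in_ideal_sq_mult[OF rr_in] in_ideal_sq_mult[OF \<eta>_in], of m "- 1"] by (simp only:)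
  then show ?thesis using ideal_eq_square_imp_unit rr_nz rr_in by blast
qed

text \<open>Differentiation kills \<open>th1(y ^ p)\<close>, so \<open>th' = d t\<close> and I = d
  (r, t) = (d).\<close>

lemma ideal_principal_if_unit:
  assumes "in_ideal rr tt 1"
  shows "\<exists>g. {cR a * u + [:pderiv th:] * v | u v. True} = {g * w | w. True}"
proof (intro exI set_eqI)
  obtain u0 v0 where 1: "1 = rr * u0 + tt * v0"
    using assms unfolding in_ideal_def by blast
  have "pderiv (monom (1 :: 'a) p) = 0"
    using of_nat_CHAR[where 'a = 'a] by (simp add: pderiv_monom)
  then have "pderiv th = smult d (pderiv th2)"
    unfolding th_def by (simp add: pderiv_add pderiv_pcompose pderiv_smult)
  then have th': "[:pderiv th:] = cR d * tt"
    by (simp add: tt_def cR_def)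
  fix z
  show "z \<in> {cR a * u + [:pderiv th:] * v | u v. True} \<longleftrightarrow> z \<in> {cR d * w | w. True}"
  proof
    assume "z \<in> {cR a * u + [:pderiv th:] * v | u v. True}"
    then obtain u v where "z = cR a * u + [:pderiv th:] * v" by blast
    then have "z = cR d * (rr * u + tt * v)"
      unfolding th' cR_a by (simp only: algebra_simps)
    then show "z \<in> {cR d * w | w. True}" by blast
  next
    assume "z \<in> {cR d * w | w. True}"
    then obtain w where "z = cR d * w" by blast
    then have "z = cR d * (rr * u0 + tt * v0) * w" using 1 by simp
    then have "z = cR a * (u0 * w) + [:pderiv th:] * (v0 * w)"
      unfolding th' cR_a by (simp only: algebra_simps)
    then show "z \<in> {cR a * u + [:pderiv th:] * v | u v. True}" by blast
  qed
qed

end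

section \<open>Contradiction from generators, and the chain rule for an isomorphism\<close>

lemma no_free_gradient:
  fixes a :: "'a::idom" and del :: "'n::finite \<Rightarrow> 'a poly poly \<Rightarrow> 'a poly poly"
    and P V :: "'n \<Rightarrow> 'a poly poly"
  assumes ufd: "ufd TYPE('a)" and char: "CHAR('a) > 0" and hyps: "hyps a th F"
    and xy: "jx \<noteq> jy" "del jx = dx" "del jy = dy"
    and P: "\<And>i. phi a th F (P i) = P i"
    and V: "\<And>k. k \<noteq> jx \<Longrightarrow> k \<noteq> jy \<Longrightarrow> phi a th F (V k) = V k"
      "\<And>j k. k \<noteq> jx \<Longrightarrow> k \<noteq> jy \<Longrightarrow> del j (V k) = (if j = k then 1 else 0)"
    and chain: "\<And>u. phi a th F u = u \<Longrightarrow> \<exists>c. \<forall>j. del j u = (\<Sum>i\<in>UNIV. c i * del j (P i))"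
  shows False
proof -
  have prime_CHAR: "prime CHAR('a)" using char by (rule prime_CHAR_semidom)
  have a: "a \<noteq> 0" and F: "F \<noteq> 0" "in_Rf F (cR a * Xv + evalY th Yv)"
    and not_principal: "\<not> (\<exists>g. {cR a * u + [:pderiv th:] * v | u v. True} = {g * w | w. True})"
    using hyps unfolding hyps_def by blast+
  obtain d c ps t1 t2 where split: "a = d * (c * prod_list ps)" "c dvd 1"
    "th = pcompose t1 (monom 1 CHAR('a)) + smult d t2"
    "\<forall>l\<in>set ps. prime_elem l \<and> \<not> [:l:] dvd pderiv t2"
    by (rule split_off_gcd[OF prime_CHAR ufd a, of th])
  define p where "p = CHAR('a)"
  interpret nagata a th F d "c * prod_list ps" t1 t2 p
    using prime_CHAR a F split(1,3) unfolding p_def[symmetric] by unfold_locales (simp_all add: p_def)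
  interpret cR: morphism cR by (rule morphism_cR)
  have "no_common_factor rr w" if w: "rr dvd w - tt ^ p" for w
  proof -
    \<comment> \<open>A prime factor \<open>l\<close> of \<open>r\<close> stays prime in R[x, y]; if
      it divided \<open>w\<close>, it would divide \<open>t ^ p\<close>, hence \<open>t\<close>,
      against the choice of \<open>ps\<close>.\<close>
    have factor: "no_common_factor (cR l) w" if l: "l \<in> set ps" for l
    proof (rule no_common_factor_prime)
      show prime: "prime_elem (cR l)"
        using bspec[OF split(4) l] unfolding cR_def by (intro lift_prime_elem_poly) simp
      show "\<not> cR l dvd w"
      proof
        assume *: "cR l dvd w"
        have "l dvd c * prod_list ps" using l by (simp add: prod_list_remove1)
        then obtain k where "c * prod_list ps = l * k" by (rule dvdE)
        then have "cR (c * prod_list ps) = cR l * cR k" by (simp only: cR.mult)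
        then have "rr = cR l * cR k" by (simp only: rr_def)
        then have "cR l dvd rr" by (rule dvdI)
        then have "cR l dvd w - tt ^ p" using w by (rule dvd_trans)
        then have "cR l dvd w - (w - tt ^ p)" by (rule dvd_diff[OF *])
        then have "cR l dvd tt ^ p" by simp
        then have "cR l dvd tt" by (rule prime_elem_dvd_power[OF prime])
        then have "[:l:] dvd pderiv t2"
          by (simp add: cR_def tt_def const_poly_dvd_const_poly_iff)
        then show False using bspec[OF split(4) l] by simp
      qed
    qed
    have "no_common_factor (cR (prod_list qs)) w" if "set qs \<subseteq> set ps" for qs
      using that
      by (induction qs) (simp_all add: cR.one cR.mult no_common_factor_unit no_common_factor_mult factor)
    moreover have "no_common_factor (cR c) w"
    proof (rule no_common_factor_unit)
      obtain k where "1 = c * k" using split(2) by (rule dvdE)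
      then have "1 = cR c * cR k" using cR.mult[of c k] cR.one by metis
      then show "cR c dvd 1" by (rule dvdI)
    qed
    ultimately show ?thesis
      by (simp add: rr_def cR.mult no_common_factor_mult)
  qed
  with ideal_is_unit_ideal[of jx jy del P V, OF xy, unfolded \<phi>_def, OF P V chain]
  have "in_ideal rr tt 1" by blast
  from ideal_principal_if_unit[OF this] not_principal show False by (rule notE[rotated])
qed

text \<open>With \<open>i\<close> the inverse isomorphism, \<open>P\<close> consists of the images
  \<open>i (X k)\<close>, and the coefficients for \<open>u = i b\<close> are the
  \<open>i (del k b)\<close>. Both sides of the chain rule are additive and obey the Leibniz rule,
  so \<open>generated\<close> reduces it to constants and variables.\<close>

lemma isomorphism_chain_rule:
  fixes a :: "'a::idom" and del :: "'n::finite \<Rightarrow> 'a poly poly \<Rightarrow> 'a poly poly"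
  assumes iso: "alg_iso_to_full emb (invariants a th F)"
    and emb: "\<And>c. phi a th F (emb c) = emb c"
    and del: "\<And>j. derivation (del j)" "\<And>j c. del j (emb c) = 0"
      "\<And>j k. del j (X k) = (if j = k then 1 else 0)"
    and generated: "\<And>Q b. (\<And>c. Q (emb c)) \<Longrightarrow> (\<And>k. Q (X k)) \<Longrightarrow>
      (\<And>u v. Q u \<Longrightarrow> Q v \<Longrightarrow> Q (u + v)) \<Longrightarrow> (\<And>u v. Q u \<Longrightarrow> Q v \<Longrightarrow> Q (u * v)) \<Longrightarrow> Q b"
  shows "\<exists>P :: 'n \<Rightarrow> 'a poly poly. (\<forall>i. phi a th F (P i) = P i) \<and>
    (\<forall>u. phi a th F u = u \<longrightarrow> (\<exists>c. \<forall>j. del j u = (\<Sum>i\<in>UNIV. c i * del j (P i))))"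
proof -
  let ?S = "invariants a th F"
  interpret phi: morphism "phi a th F"
    unfolding phi_def[abs_def] by (rule morphism_eval2)
  from iso obtain h where bij: "bij_betw h ?S UNIV"
    and h: "\<And>u v. u \<in> ?S \<Longrightarrow> v \<in> ?S \<Longrightarrow> h (u + v) = h u + h v"
      "\<And>u v. u \<in> ?S \<Longrightarrow> v \<in> ?S \<Longrightarrow> h (u * v) = h u * h v"
      "h 1 = 1" "\<And>c u. u \<in> ?S \<Longrightarrow> h (emb c * u) = emb c * h u"
    unfolding alg_iso_to_full_def by blast
  define i where "i = inv_into ?S h"
  have iS: "i b \<in> ?S" and hi: "h (i b) = b" for b
    using bij inv_into_into[of b h ?S] f_inv_into_f[of b h ?S] unfolding i_def bij_betw_def by auto
  have ih: "i (h u) = u" if "u \<in> ?S" for u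
    using bij that unfolding i_def bij_betw_def by (intro inv_into_f_f) auto
  have S_add: "u + v \<in> ?S" and S_mult: "u * v \<in> ?S" if "u \<in> ?S" "v \<in> ?S" for u v
    using that by (simp_all add: invariants_def phi.add phi.mult)
  have S_1: "1 \<in> ?S" and S_emb: "emb c \<in> ?S" for c
    by (simp_all add: invariants_def phi.one emb)
  interpret i: morphism i
  proof
    show "i (u + v) = i u + i v" for u v
      using ih[OF S_add[OF iS iS], of u v] by (simp add: h iS hi)
    show "i (u * v) = i u * i v" for u v
      using ih[OF S_mult[OF iS iS], of u v] by (simp add: h iS hi)
    show "i 1 = 1"
      using ih[OF S_1] by (simp add: h)
  qed
  \<comment> \<open>Linearity applied to \<open>emb c * 1\<close> shows that \<open>h\<close>, and
    so \<open>i\<close>, fixes the constants.\<close>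
  have i_emb: "i (emb c) = emb c" for c
    using ih[OF S_emb, of c] h(4)[OF S_1, of c] by (simp add: h)
  have chain: "\<forall>j. del j (i b) = (\<Sum>k\<in>UNIV. i (del k b) * del j (i (X k)))" for b
  proof (rule generated[of "\<lambda>b. \<forall>j. del j (i b) = (\<Sum>k\<in>UNIV. i (del k b) * del j (i (X k)))"])
    show "\<forall>j. del j (i (emb c)) = (\<Sum>k\<in>UNIV. i (del k (emb c)) * del j (i (X k)))" for c
      by (simp add: i_emb del i.zero)
    show "\<forall>j. del j (i (X m)) = (\<Sum>k\<in>UNIV. i (del k (X m)) * del j (i (X k)))" for m
      by (simp add: del if_distrib[of i] i.zero i.one if_distribR if_distrib[of "\<lambda>x. x * _"] cong: if_cong)
    fix u v assume *: "\<forall>j. del j (i u) = (\<Sum>k\<in>UNIV. i (del k u) * del j (i (X k)))"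
      "\<forall>j. del j (i v) = (\<Sum>k\<in>UNIV. i (del k v) * del j (i (X k)))"
    show "\<forall>j. del j (i (u + v)) = (\<Sum>k\<in>UNIV. i (del k (u + v)) * del j (i (X k)))"
      using * by (simp add: i.add derivation.add[OF del(1)] distrib_right sum.distrib)
    show "\<forall>j. del j (i (u * v)) = (\<Sum>k\<in>UNIV. i (del k (u * v)) * del j (i (X k)))"
      using * by (simp add: i.add i.mult derivation.mult[OF del(1)] distrib_right sum.distrib
          sum_distrib_left mult.assoc)
  qed
  show ?thesis
  proof (rule exI[of _ "\<lambda>k. i (X k)"], intro conjI allI impI)
    show "phi a th F (i (X k)) = i (X k)" for k
      using iS[of "X k"] by (simp add: invariants_def)
    show "\<exists>c. \<forall>j. del j u = (\<Sum>k\<in>UNIV. c k * del j (i (X k)))" if "phi a th F u = u" for u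
      using chain[of "h u"] ih[of u] that
      by (intro exI[of _ "\<lambda>k. i (del k (h u))"]) (simp add: invariants_def)
  qed
qed

section \<open>Partial derivatives with respect to the variables of the ground ring\<close>

lemma poly_mapping_induct_add:
  fixes m :: "'b \<Rightarrow>\<^sub>0 'c::comm_monoid_add"
  assumes "\<And>k c. Q (Poly_Mapping.single k c)" "\<And>f g. Q f \<Longrightarrow> Q g \<Longrightarrow> Q (f + g)"
  shows "Q m"
proof -
  have sum: "Q (\<Sum>k\<in>A. Poly_Mapping.single k (Poly_Mapping.lookup m k))" if "finite A" for A
    using that
  proof (induction A rule: finite_induct)
    case empty
    then show ?case using assms(1)[of _ 0] by simp
  qed (simp add: assms)
  have "m = (\<Sum>k\<in>Poly_Mapping.keys m. Poly_Mapping.single k (Poly_Mapping.lookup m k))"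
    by (intro poly_mapping_eqI) (simp add: lookup_sum lookup_single when_def in_keys_iff)
  with sum[OF finite_keys, of m] show ?thesis by simp
qed

text \<open>The formal derivative by variable \<open>i\<close>, exponent vectors standing for
  monomials.\<close>

definition partial :: "'n \<Rightarrow> (('n \<Rightarrow>\<^sub>0 nat) \<Rightarrow>\<^sub>0 'k::semiring_1) \<Rightarrow> (('n \<Rightarrow>\<^sub>0 nat) \<Rightarrow>\<^sub>0 'k)" where
  "partial i f = Abs_poly_mapping (\<lambda>m. of_nat (Poly_Mapping.lookup m i + 1) *
     Poly_Mapping.lookup f (m + Poly_Mapping.single i 1))"

lemma lookup_partial:
  "Poly_Mapping.lookup (partial i f) m = of_nat (Poly_Mapping.lookup m i + 1) *
     Poly_Mapping.lookup f (m + Poly_Mapping.single i 1)"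
proof -
  have "finite ((\<lambda>m. m + Poly_Mapping.single i 1) -` {m. Poly_Mapping.lookup f m \<noteq> 0})"
    by (intro finite_vimageI) (auto simp: inj_on_def)
  then have "finite {m. of_nat (Poly_Mapping.lookup m i + 1) *
     Poly_Mapping.lookup f (m + Poly_Mapping.single i 1) \<noteq> 0}"
    by (rule rev_finite_subset) auto
  then show ?thesis
    unfolding partial_def by simp
qed

lemma partial_add: "partial i (f + g) = partial i f + partial i g"
  by (intro poly_mapping_eqI) (simp add: lookup_partial lookup_add distrib_left)

text \<open>Subtraction of exponents truncates at 0; this is harmless because the factor
  \<open>lookup m i\<close> is 0 in that case.\<close>

lemma partial_single:
  "partial i (Poly_Mapping.single m c) =
     Poly_Mapping.single (m - Poly_Mapping.single i 1) (of_nat (Poly_Mapping.lookup m i) * c)"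
proof (intro poly_mapping_eqI)
  fix k
  let ?e = "Poly_Mapping.single i (1 :: nat)"
  show "Poly_Mapping.lookup (partial i (Poly_Mapping.single m c)) k =
    Poly_Mapping.lookup (Poly_Mapping.single (m - ?e) (of_nat (Poly_Mapping.lookup m i) * c)) k"
  proof (cases "Poly_Mapping.lookup m i = 0")
    case True
    then have "m \<noteq> k + ?e"
      by (metis add_is_0 lookup_add lookup_single_eq one_neq_zero)
    then show ?thesis using True by (simp add: lookup_partial lookup_single)
  next
    case False
    have "m - ?e + ?e = m"
      using False by (intro poly_mapping_eqI) (auto simp: lookup_add lookup_minus lookup_single when_def)
    then have "m = k + ?e \<longleftrightarrow> m - ?e = k" by (metis add_diff_cancel_right')
    moreover have "Poly_Mapping.lookup m i = Poly_Mapping.lookup k i + 1" if "m = k + ?e"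
      using that by (simp add: lookup_add)
    ultimately show ?thesis by (auto simp: lookup_partial lookup_single when_def)
  qed
qed

lemma derivation_partial:
  "derivation (partial i :: (('n::linorder \<Rightarrow>\<^sub>0 nat) \<Rightarrow>\<^sub>0 'k::field) \<Rightarrow> _)"
proof
  let ?e = "Poly_Mapping.single i (1 :: nat)"
  fix f g :: "('n \<Rightarrow>\<^sub>0 nat) \<Rightarrow>\<^sub>0 'k"
  show "partial i (f + g) = partial i f + partial i g" by (rule partial_add)
  show "partial i (f * g) = f * partial i g + g * partial i f"
  proof (induction f rule: poly_mapping_induct_add)
    case (1 m c)
    show ?case
    proof (induction g rule: poly_mapping_induct_add)
      case (1 n c')
      \<comment> \<open>Truncated subtraction commutes with adding \<open>m\<close> when variable
        \<open>i\<close> occurs in \<open>n\<close>; otherwise both coefficients vanish.\<close>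
      have *: "Poly_Mapping.single (m + (n - ?e)) (of_nat (Poly_Mapping.lookup n i) * c) =
          Poly_Mapping.single (m + n - ?e) (of_nat (Poly_Mapping.lookup n i) * c)"
        for m n :: "'n \<Rightarrow>\<^sub>0 nat" and c :: 'k
      proof (cases "Poly_Mapping.lookup n i = 0")
        case False
        then have "m + (n - ?e) = m + n - ?e"
          by (intro poly_mapping_eqI) (auto simp: lookup_add lookup_minus lookup_single when_def)
        then show ?thesis by simp
      qed simp
      have "partial i (Poly_Mapping.single m c * Poly_Mapping.single n c') =
          Poly_Mapping.single (m + n - ?e) (of_nat (Poly_Mapping.lookup n i) * (c * c'))
          + Poly_Mapping.single (m + n - ?e) (of_nat (Poly_Mapping.lookup m i) * (c * c'))"
        by (simp add: mult_single partial_single lookup_add algebra_simps flip: single_add)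
      also have "\<dots> = Poly_Mapping.single (m + (n - ?e)) (of_nat (Poly_Mapping.lookup n i) * (c * c'))
          + Poly_Mapping.single (n + (m - ?e)) (of_nat (Poly_Mapping.lookup m i) * (c * c'))"
        unfolding * by (simp add: add.commute)
      also have "\<dots> = Poly_Mapping.single m c * partial i (Poly_Mapping.single n c')
          + Poly_Mapping.single n c' * partial i (Poly_Mapping.single m c)"
        by (simp add: mult_single partial_single ac_simps)
      finally show ?case .
    next
      case (2 g g')
      then show ?case by (simp add: partial_add algebra_simps)
    qed
  next
    case (2 f f')
    then show ?case by (simp add: partial_add algebra_simps)
  qed
qed

lemma poly_mapping_generated:
  fixes f :: "('n::linorder \<Rightarrow>\<^sub>0 nat) \<Rightarrow>\<^sub>0 'k::field"
  assumes const: "\<And>c. Q (Poly_Mapping.single 0 c)"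
    and var: "\<And>i. Q (Poly_Mapping.single (Poly_Mapping.single i 1) 1)"
    and add: "\<And>u v. Q u \<Longrightarrow> Q v \<Longrightarrow> Q (u + v)" and mult: "\<And>u v. Q u \<Longrightarrow> Q v \<Longrightarrow> Q (u * v)"
  shows "Q f"
proof (induction f rule: poly_mapping_induct_add)
  case (1 m c)
  have "Q (Poly_Mapping.single m 1)"
  proof (induction m rule: poly_mapping_induct_add)
    case (1 i n)
    show ?case
    proof (induction n)
      case 0
      then show ?case using const[of 1] by simp
    next
      case (Suc n)
      have "Poly_Mapping.single (Poly_Mapping.single i (Suc n)) (1 :: 'k) =
          Poly_Mapping.single (Poly_Mapping.single i 1) 1 * Poly_Mapping.single (Poly_Mapping.single i n) 1"
        by (simp add: mult_single flip: single_add)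
      then show ?case using mult[OF var Suc] by simp
    qed
  next
    case (2 m n)
    have "Poly_Mapping.single (m + n) (1 :: 'k) = Poly_Mapping.single m 1 * Poly_Mapping.single n 1"
      by (simp add: mult_single)
    then show ?case using mult[OF 2] by simp
  qed
  moreover have "Poly_Mapping.single m c = Poly_Mapping.single 0 c * Poly_Mapping.single m 1"
    by (simp add: mult_single)
  ultimately show ?case using mult[OF const] by simp
next
  case (2 f g)
  then show ?case by (rule add)
qed

lemma CHAR_poly_mapping_pos:
  assumes "CHAR('k::field) > 0"
  shows "CHAR(('n::linorder \<Rightarrow>\<^sub>0 nat) \<Rightarrow>\<^sub>0 'k) > 0"
proof -
  have "(of_nat CHAR('k) :: ('n \<Rightarrow>\<^sub>0 nat) \<Rightarrow>\<^sub>0 'k) = Poly_Mapping.single 0 (of_nat CHAR('k))"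
    by (simp only: single_of_nat)
  also have "\<dots> = 0" by simp
  finally show ?thesis using assms CHAR_pos_iff by blast
qed

section \<open>Isomorphisms over R and over k\<close>

lemma not_isomorphic_over_ground_ring:
  fixes a :: "'a::idom"
  assumes "ufd TYPE('a)" "CHAR('a) > 0" "hyps a th F"
  shows "\<not> alg_iso_to_full (cR :: 'a \<Rightarrow> 'a poly poly) (invariants a th F)"
proof
  assume iso: "alg_iso_to_full (cR :: 'a \<Rightarrow> 'a poly poly) (invariants a th F)"
  define del :: "bool \<Rightarrow> 'a poly poly \<Rightarrow> 'a poly poly" where "del = (\<lambda>j. if j then dx else dy)"
  define X :: "bool \<Rightarrow> 'a poly poly" where "X = (\<lambda>j. if j then Xv else Yv)"
  have "\<exists>P :: bool \<Rightarrow> 'a poly poly. (\<forall>i. phi a th F (P i) = P i) \<and>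
    (\<forall>u. phi a th F u = u \<longrightarrow> (\<exists>c. \<forall>j. del j u = (\<Sum>i\<in>UNIV. c i * del j (P i))))"
  proof (rule isomorphism_chain_rule[OF iso, of del X])
    show "phi a th F (cR c) = cR c" for c by (simp add: phi_def)
    show "derivation (del j)" for j
      by (simp add: del_def derivation_dx derivation_dy)
    show "del j (cR c) = 0" for j c by (simp add: del_def)
    show "del j (X k) = (if j = k then 1 else 0)" for j k by (simp add: del_def X_def)
    show "Q b" if "\<And>c. Q (cR c)" "\<And>k. Q (X k)" "\<And>u v. Q u \<Longrightarrow> Q v \<Longrightarrow> Q (u + v)"
      "\<And>u v. Q u \<Longrightarrow> Q v \<Longrightarrow> Q (u * v)" for Q b
    proof (rule poly2_generated[of Q])
      show "Q Xv" "Q Yv" using that(2)[of True] that(2)[of False] by (simp_all add: X_def)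
    qed (fact that)+
  qed
  then obtain P :: "bool \<Rightarrow> 'a poly poly" where P: "\<forall>i. phi a th F (P i) = P i"
    "\<forall>u. phi a th F u = u \<longrightarrow> (\<exists>c. \<forall>j. del j u = (\<Sum>i\<in>UNIV. c i * del j (P i)))"
    by (elim exE conjE) (rule that, assumption, assumption)
  show False
    by (rule no_free_gradient[OF assms _ _ _ P(1)[rule_format] _ _ P(2)[rule_format], of True False X]) (simp_all add: del_def)
qed

text \<open>An isomorphism over k may move the variables of R, so derivatives by all n + 2 variables
  enter; \<open>Inl i\<close> indexes \<open>z i\<close>, and \<open>Inr\<close> indexes x and
  y.\<close>

lemma not_isomorphic_over_field:
  fixes a :: "('n::{finite,linorder} \<Rightarrow>\<^sub>0 nat) \<Rightarrow>\<^sub>0 'k::field"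
  assumes ufd: "ufd TYPE(('n \<Rightarrow>\<^sub>0 nat) \<Rightarrow>\<^sub>0 'k)" and char: "CHAR('k) > 0" and hyps: "hyps a th F"
  shows "\<not> alg_iso_to_full (\<lambda>c::'k. cR (Poly_Mapping.single 0 c)) (invariants a th F)"
proof
  assume iso: "alg_iso_to_full (\<lambda>c::'k. cR (Poly_Mapping.single 0 c)) (invariants a th F)"
  let ?x = "Inr True :: 'n + bool" and ?y = "Inr False :: 'n + bool"
  define z :: "'n \<Rightarrow> ('n \<Rightarrow>\<^sub>0 nat) \<Rightarrow>\<^sub>0 'k"
    where "z i = Poly_Mapping.single (Poly_Mapping.single i 1) 1" for i
  define dz :: "'n \<Rightarrow> (('n \<Rightarrow>\<^sub>0 nat) \<Rightarrow>\<^sub>0 'k) poly poly \<Rightarrow> _" where "dz i = map_poly (map_poly (partial i))" for i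
  define del where "del = case_sum dz (\<lambda>j. if j then dx else dy)"
  define X where "X = case_sum (\<lambda>i. cR (z i)) (\<lambda>j. if j then Xv else Yv)"
  have der_dz: "derivation (dz i)" for i
    unfolding dz_def by (intro derivation.map_poly_derivation derivation_partial)
  have partial_0: "partial i 0 = (0 :: ('n \<Rightarrow>\<^sub>0 nat) \<Rightarrow>\<^sub>0 'k)"
    and partial_1: "partial i 1 = (0 :: ('n \<Rightarrow>\<^sub>0 nat) \<Rightarrow>\<^sub>0 'k)" for i :: 'n
    by (simp_all only: derivation.zero[OF derivation_partial] derivation.one[OF derivation_partial])
  have dz_cR: "dz i (cR c) = cR (partial i c)" for i c
    by (simp add: dz_def cR_def map_poly_pCons partial_0)
  have dz_Xv: "dz i Xv = 0" and dz_Yv: "dz i Yv = 0" for i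
    by (simp_all add: dz_def Xv_def Yv_def map_poly_pCons partial_0 map_poly_1 partial_1)
  have partial_z: "partial i (z k) = (if i = k then 1 else 0)" for i k
    by (simp add: z_def partial_single lookup_single when_def)
  have delX: "del j (X k) = (if j = k then 1 else 0)" for j k
    by (cases j; cases k) (auto simp: del_def X_def dz_cR dz_Xv dz_Yv partial_z
        morphism.one[OF morphism_cR] morphism.zero[OF morphism_cR])
  have phi_cR: "phi a th F (cR c) = cR c" for c by (simp add: phi_def)
  have "\<exists>P :: 'n + bool \<Rightarrow> _. (\<forall>i. phi a th F (P i) = P i) \<and>
    (\<forall>u. phi a th F u = u \<longrightarrow> (\<exists>c. \<forall>j. del j u = (\<Sum>i\<in>UNIV. c i * del j (P i))))"
  proof (rule isomorphism_chain_rule[OF iso, of del X])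
    show "phi a th F (cR (Poly_Mapping.single 0 c)) = cR (Poly_Mapping.single 0 c)" for c
      by (rule phi_cR)
    show "derivation (del j)" for j
      by (cases j) (simp_all add: del_def derivation_dx derivation_dy der_dz)
    show "del j (cR (Poly_Mapping.single 0 c)) = 0" for j and c :: 'k
      by (cases j) (simp_all add: del_def dz_cR partial_single morphism.zero[OF morphism_cR])
    show "del j (X k) = (if j = k then 1 else 0)" for j k by (rule delX)
    show "Q b" if Q: "\<And>c. Q (cR (Poly_Mapping.single 0 c))" "\<And>k. Q (X k)"
      "\<And>u v. Q u \<Longrightarrow> Q v \<Longrightarrow> Q (u + v)" "\<And>u v. Q u \<Longrightarrow> Q v \<Longrightarrow> Q (u * v)" for Q b
    proof (rule poly2_generated[of Q])
      show "Q (cR c)" for c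
      proof (induction c rule: poly_mapping_generated)
        case (2 i)
        then show ?case using Q(2)[of "Inl i"] by (simp add: X_def z_def)
      qed (simp_all add: Q morphism.add[OF morphism_cR] morphism.mult[OF morphism_cR])
      show "Q Xv" "Q Yv" using Q(2)[of ?x] Q(2)[of ?y] by (simp_all add: X_def)
    qed (fact Q(3,4))+
  qed
  then obtain P :: "'n + bool \<Rightarrow> _" where P: "\<forall>i. phi a th F (P i) = P i"
    "\<forall>u. phi a th F u = u \<longrightarrow> (\<exists>c. \<forall>j. del j u = (\<Sum>i\<in>UNIV. c i * del j (P i)))"
    by (elim exE conjE) (rule that, assumption, assumption)
  show False
  proof (rule no_free_gradient[OF ufd CHAR_poly_mapping_pos[OF char] hyps _ _ _ P(1)[rule_format] _ delX P(2)[rule_format], of ?x ?y])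
    show "phi a th F (X k) = X k" if "k \<noteq> ?x" "k \<noteq> ?y" for k
      using that by (cases k) (auto simp: X_def phi_cR)
  qed (simp_all add: del_def)
qed

theorem theorem6p21:
  shows "(\<forall>(a::'a::idom) th F.
            ufd TYPE('a) \<and> CHAR('a) > 0 \<and> hyps a th F \<longrightarrow>
            \<not> alg_iso_to_full (cR :: 'a \<Rightarrow> 'a poly poly) (invariants a th F))
       \<and> (\<forall>(a::('n::{finite,linorder} \<Rightarrow>\<^sub>0 nat) \<Rightarrow>\<^sub>0 'k::field) th F.
            ufd TYPE(('n \<Rightarrow>\<^sub>0 nat) \<Rightarrow>\<^sub>0 'k) \<and> CHAR('k) > 0 \<and> hyps a th F \<longrightarrow>
            \<not> alg_iso_to_full (\<lambda>c::'k. cR (Poly_Mapping.single 0 c))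
                 (invariants a th F))"
  using not_isomorphic_over_ground_ring not_isomorphic_over_field by blast

end
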